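(* Let $v\geq 2$ be an integer. There exists a 1-rotational S$(2,4,v)$ if and only if $v\equiv 4\pmod{12}$ and $v\neq 28$.
   Context: A Steiner system S$(2,k,v)$ is a pair $(X,\mathcal{B})$ where $X$ is a set of $v$ points and $\mathcal{B}$ is a family of $k$-subsets of $X$ (called blocks) such that every two distinct points of $X$ are contained in exactly one block. An automorphism is a permutation of $X$ leaving $\mathcal{B}$ invariant. An S$(2,k,v)$ is 1-rotational if it admits an automorphism consisting of one fixed point and a cycle of length $v-1$; equivalently, up to isomorphism, $X=\mathbb{Z}_{v-1}\cup\{\infty\}$ and the permutation $i\mapsto i+1\pmod{v-1}$ for $i\in\mathbb{Z}_{v-1}$, $\infty\mapsto\infty$, is an automorphism. *)

theory Defs
  imports "HOL-Combinatorics.Combinatorics" "HOL-Number_Theory.Cong"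
begin

definition steiner_system_2 :: "nat \<Rightarrow> nat \<Rightarrow> 'a set \<Rightarrow> 'a set set \<Rightarrow> bool" where
  "steiner_system_2 k v X \<B> \<longleftrightarrow>
     finite X \<and> card X = v \<and>
     (\<forall>B\<in>\<B>. B \<subseteq> X \<and> card B = k) \<and>
     (\<forall>x\<in>X. \<forall>y\<in>X. x \<noteq> y \<longrightarrow> (\<exists>!B. B \<in> \<B> \<and> x \<in> B \<and> y \<in> B))"

definition design_automorphism :: "('a \<Rightarrow> 'a) \<Rightarrow> 'a set \<Rightarrow> 'a set set \<Rightarrow> bool" where
  "design_automorphism f X \<B> \<longleftrightarrow> f permutes X \<and> (\<lambda>B. f ` B) ` \<B> = \<B>"

text \<open>
  \<^term>\<open>cyclic_on f (X - {p})\<close> says that \<^term>\<open>X - {p}\<close> is a single orbit of \<^term>\<open>f\<close>;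
  since \<^term>\<open>card X = v\<close>, this is a cycle of length \<^term>\<open>v - 1\<close>.
\<close>

definition one_rotational_steiner_system_2 ::
    "nat \<Rightarrow> nat \<Rightarrow> 'a set \<Rightarrow> 'a set set \<Rightarrow> bool" where
  "one_rotational_steiner_system_2 k v X \<B> \<longleftrightarrow>
     steiner_system_2 k v X \<B> \<and>
     (\<exists>f. design_automorphism f X \<B> \<and>
          (\<exists>p\<in>X. f p = p \<and> cyclic_on f (X - {p})))"

end

theory Submission
  imports Defs
begin

text \<open>
  Put \<open>n = v - 1\<close>. The blocks avoiding the fixed point fall into translation classes of quadruples in
  \<open>\<int>\<^sub>n\<close>, and each nonzero difference belongs to exactly one class. The blocks through the fixed point
  account for two differences, namely \<open>\<plusminus>n/3\<close>, and a quadruple with trivial stabilizer for twelve. A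
  nontrivial stabilizer forces the subgroup of order 4, which accounts for three differences; counting then
  gives \<open>n - 1 = 2 + 3 + 12 j\<close>, against \<open>4 dvd n\<close>. Hence \<open>n = 12 k + 3\<close>, and \<open>n = 27\<close> is
  excluded by a finite search.

  Conversely, \<open>k\<close> quadruples whose differences cover \<open>1, \<dots>, 6 k + 1\<close> up to sign, except \<open>4 k + 1 = n/3\<close>,
  are enough: there are only \<open>12 k\<close> signed differences, so the cover is automatically exact. For \<open>k = 6 m + c\<close>
  with \<open>6 \<le> c \<le> 11\<close>, take six families of \<open>m\<close> quadruples of the shape
  \<open>0, a\<^sub>1 m + b\<^sub>1 + i, a\<^sub>2 m + b\<^sub>2 + 2 i, a\<^sub>3 m + b\<^sub>3 + 3 i\<close> with \<open>i < m\<close>, and \<open>c\<close> quadruples whose entries are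
  linear in \<open>m\<close>. Each family contributes three progressions of step 1, two of step 2 and one of step 3.
  Interleaving those of step 2 in pairs and those of step 3 in triples tiles the range up to a bounded number of
  gaps next to the multiples of \<open>m\<close>, which the other \<open>c\<close> quadruples fill. The coefficients come from
  a computer search; that they work for every \<open>m\<close> is a finite check on the coefficients.
\<close>

section \<open>Base blocks and 1-rotational systems\<close>

definition covers_differences :: "int \<Rightarrow> int set set \<Rightarrow> int \<Rightarrow> bool" where
  "covers_differences n \<F> d \<longleftrightarrow> (\<exists>b\<in>\<F>. \<exists>x\<in>b. \<exists>y\<in>b. [y - x = d] (mod n))"

lemma card_off_diagonal:
  assumes "finite b"
  shows "card {(x, y). x \<in> b \<and> y \<in> b \<and> x \<noteq> y} = card b * (card b - 1)"
proof -
  have "{(x, y). x \<in> b \<and> y \<in> b \<and> x \<noteq> y} = (SIGMA x:b. b - {x})" by auto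
  then show ?thesis using assms by (simp add: card_Diff_singleton)
qed

text \<open>The bounds leave no slack: at most \<open>k\<close> blocks with at most twelve ordered
  pairs each have to reach all \<open>12 * k\<close> elements of the target set. So the difference
  map is a bijection and every block has four elements.\<close>

lemma difference_cover_exact:
  fixes n k :: int and \<F> :: "int set set"
  assumes n: "n = 12 * k + 3" "k \<ge> 0"
    and fin: "finite \<F>" and card: "card \<F> \<le> nat k"
    and blk: "\<And>b. b \<in> \<F> \<Longrightarrow> finite b \<and> card b \<le> 4"
    and cov: "\<And>d. 1 \<le> d \<Longrightarrow> d \<le> 6 * k + 1 \<Longrightarrow> d \<noteq> 4 * k + 1 \<Longrightarrow> covers_differences n \<F> d"
  defines "T \<equiv> (SIGMA b:\<F>. {(x, y). x \<in> b \<and> y \<in> b \<and> x \<noteq> y})"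
  shows "bij_betw (\<lambda>(b, x, y). (y - x) mod n) T ({1..<n} - {4 * k + 1, 8 * k + 2})"
    and "\<And>b. b \<in> \<F> \<Longrightarrow> card b = 4"
proof -
  let ?g = "\<lambda>(b :: int set, x, y). (y - x) mod n"
  let ?D = "{1..<n} - {4 * k + 1, 8 * k + 2}"
  let ?o = "\<lambda>b :: int set. {(x, y). x \<in> b \<and> y \<in> b \<and> x \<noteq> y}"
  have fo: "finite (?o b)" if "b \<in> \<F>" for b
    by (rule finite_subset[of _ "b \<times> b"]) (use blk[OF that] in auto)
  have le12: "card (?o b) \<le> 12" if "b \<in> \<F>" for b
  proof -
    have "card b * (card b - 1) \<le> 4 * 3"
      by (intro mult_mono) (use blk[OF that] in auto)
    then show ?thesis using card_off_diagonal[of b] blk[OF that] by simp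
  qed
  have finT: "finite T" unfolding T_def using fin fo by auto
  have cT: "card T = (\<Sum>b\<in>\<F>. card (?o b))" unfolding T_def using fin fo by (intro card_SigmaI) auto
  have sum12: "(\<Sum>b\<in>\<F>. card (?o b)) \<le> (\<Sum>b\<in>\<F>. 12)" by (intro sum_mono le12)
  have leT: "card T \<le> 12 * nat k" using sum12 card cT by simp
  have sub: "?D \<subseteq> ?g ` T"
  proof
    fix d assume d: "d \<in> ?D"
    \<comment> \<open>A difference in the upper half comes from swapping the pair that yields
      \<open>n - d\<close>; under this reflection \<open>8 * k + 2\<close> goes to the excluded
      value \<open>4 * k + 1\<close>.\<close>
    define e where "e = (if d \<le> 6 * k + 1 then d else n - d)"
    have "1 \<le> e" "e \<le> 6 * k + 1" "e \<noteq> 4 * k + 1" using d n unfolding e_def by auto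
    from cov[OF this] obtain b x y where b: "b \<in> \<F>" "x \<in> b" "y \<in> b" "[y - x = e] (mod n)"
      unfolding covers_differences_def by blast
    have eb: "1 \<le> e" "e < n" using d n unfolding e_def by auto
    have ne: "x \<noteq> y"
    proof
      assume "x = y"
      then have "n dvd e" using b(4) by (simp add: cong_iff_dvd_diff)
      then show False using eb zdvd_imp_le[of n e] by auto
    qed
    show "d \<in> ?g ` T"
    proof (cases "d \<le> 6 * k + 1")
      case True
      then have "(y - x) mod n = d" using b(4) eb by (simp add: e_def cong_def)
      then show ?thesis using b ne unfolding T_def by force
    next
      case False
      then have "e = n - d" by (simp add: e_def)
      then have "[- (y - x) = - (n - d)] (mod n)" using b(4) by (simp only: cong_minus_minus_iff)
      then have "(x - y) mod n = d mod n" by (simp add: cong_def)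
      then have "(x - y) mod n = d" using d by simp
      then show ?thesis using b ne unfolding T_def by force
    qed
  qed
  have "{4 * k + 1, 8 * k + 2} \<subseteq> {1..<n}" using n by auto
  then have cD: "card ?D = 12 * nat k"
    using n by (subst card_Diff_subset) (auto simp: nat_add_distrib nat_mult_distrib)
  have ci: "card ?D \<le> card (?g ` T)" using sub finT by (intro card_mono) auto
  have ci2: "card (?g ` T) \<le> card T" using finT by (rule card_image_le)
  have cTe: "card T = 12 * nat k" using cD ci ci2 leT by simp
  have "inj_on ?g T" using cD ci ci2 cTe by (intro eq_card_imp_inj_on finT) simp
  moreover have "?D = ?g ` T" using finT sub cD ci2 cTe by (intro card_seteq) auto
  ultimately show "bij_betw ?g T ?D" by (simp add: bij_betw_def)
  fix b assume b: "b \<in> \<F>"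
  have "(\<Sum>b\<in>\<F>. card (?o b)) = (\<Sum>b\<in>\<F>. 12)"
    using cTe cT sum12 card by simp
  \<comment> \<open>Equal sums with termwise bounds force every term to attain its bound 12.\<close>
  from sum_mono_inv[OF this le12 b fin] have "card b * (card b - 1) = 12"
    using card_off_diagonal[of b] blk[OF b] by simp
  moreover have "c = 4" if "c * (c - 1) = 12" "c \<le> 4" for c :: nat
  proof -
    have "c = 0 \<or> c = 1 \<or> c = 2 \<or> c = 3 \<or> c = 4" using that(2) by linarith
    then show ?thesis using that(1) by auto
  qed
  ultimately show "card b = 4" using blk[OF b] by blast
qed

text \<open>The points are the residues below \<open>N\<close> and the point \<open>N\<close>, which
  plays the part of infinity. The blocks are the translates of the base blocks and the cosets of
  \<open>{0, q, 2 * q}\<close> enlarged by \<open>N\<close>, where \<open>q\<close> is a third of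
  \<open>n\<close>. Residues at difference \<open>q\<close> or \<open>2 * q\<close> share one coset;
  any other nonzero difference comes from exactly one pair of one base block, and this determines
  the translate.\<close>

lemma one_rotational_of_difference_cover:
  fixes n k :: int and \<F> :: "int set set"
  assumes n: "n = 12 * k + 3" "k \<ge> 0"
    and fin: "finite \<F>" and card: "card \<F> \<le> nat k"
    and blk: "\<And>b. b \<in> \<F> \<Longrightarrow> finite b \<and> card b \<le> 4"
    and cov: "\<And>d. 1 \<le> d \<Longrightarrow> d \<le> 6 * k + 1 \<Longrightarrow> d \<noteq> 4 * k + 1 \<Longrightarrow> covers_differences n \<F> d"
  shows "\<exists>(X :: nat set) \<B>. one_rotational_steiner_system_2 4 (nat n + 1) X \<B>"
proof -
  define T where "T = (SIGMA b:\<F>. {(x, y). x \<in> b \<and> y \<in> b \<and> x \<noteq> y})"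
  note exact = difference_cover_exact[OF assms, folded T_def]
  define q where "q = 4 * k + 1"
  have nq: "n = 3 * q" and q0: "q > 0" and n0: "n > 0" using n by (auto simp: q_def)
  define N where "N = nat n"
  define pt :: "int \<Rightarrow> nat" where "pt x = nat (x mod n)" for x
  define f where "f i = (if i < N then pt (int i + 1) else i)" for i :: nat
  define Fin where "Fin b t = (\<lambda>x. pt (x + t)) ` b" for b t
  define Inf where "Inf t = insert N {pt t, pt (t + q), pt (t + 2 * q)}" for t
  define \<B> where "\<B> = {Fin b t | b t. b \<in> \<F>} \<union> range Inf"
  have pt_lt: "pt x < N" for x using n0 by (simp add: pt_def N_def)
  have pt_ne: "pt x \<noteq> N" "N \<noteq> pt x" for x using pt_lt[of x] by auto
  have pt_eq: "pt x = pt y \<longleftrightarrow> n dvd (y - x)" for x y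
  proof -
    have "pt x = pt y \<longleftrightarrow> x mod n = y mod n"
      unfolding pt_def using n0 by (subst nat_eq_iff) simp
    also have "\<dots> \<longleftrightarrow> n dvd (y - x)" by (simp add: mod_eq_dvd_iff dvd_diff_commute)
    finally show ?thesis .
  qed
  have pt_surj: "\<exists>x. i = pt x" if "i < N" for i
    using that by (intro exI[of _ "int i"]) (simp add: pt_def N_def)
  have f_pt: "f (pt x) = pt (x + 1)" for x
  proof -
    have "f (pt x) = pt (int (pt x) + 1)" using pt_lt by (simp add: f_def)
    also have "\<dots> = pt (x + 1)" using n0 by (simp add: pt_def mod_add_left_eq)
    finally show ?thesis .
  qed
  have f_N: "f N = N" by (simp add: f_def)
  have f_Fin: "f ` Fin b t = Fin b (t + 1)" for b t
    by (auto simp: Fin_def f_pt image_image add.assoc)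
  have f_Inf: "f ` Inf t = Inf (t + 1)" for t
    by (simp add: Inf_def f_pt f_N algebra_simps)
  have aut: "(\<lambda>B. f ` B) ` \<B> = \<B>"
  proof
    show "(\<lambda>B. f ` B) ` \<B> \<subseteq> \<B>" unfolding \<B>_def using f_Fin f_Inf by blast
    have "Fin b t \<in> (\<lambda>B. f ` B) ` \<B>" if "b \<in> \<F>" for b t
      using that f_Fin[of b "t - 1"] unfolding \<B>_def by (intro image_eqI[of _ _ "Fin b (t - 1)"]) auto
    moreover have "Inf t \<in> (\<lambda>B. f ` B) ` \<B>" for t
      using f_Inf[of "t - 1"] unfolding \<B>_def by (intro image_eqI[of _ _ "Inf (t - 1)"]) auto
    ultimately show "\<B> \<subseteq> (\<lambda>B. f ` B) ` \<B>" unfolding \<B>_def by fastforce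
  qed
  have surj: "f ` {..N} = {..N}"
  proof
    show "f ` {..N} \<subseteq> {..N}" using pt_lt by (auto simp: f_def less_imp_le)
    show "{..N} \<subseteq> f ` {..N}"
    proof
      fix i assume "i \<in> {..N}"
      then consider "i = N" | x where "i = pt x" using pt_surj by fastforce
      then show "i \<in> f ` {..N}"
      proof cases
        case 1
        then show ?thesis using f_N by (intro image_eqI[of _ _ N]) auto
      next
        case 2
        then show ?thesis using f_pt[of "x - 1"] pt_lt[of "x - 1"]
          by (intro image_eqI[of _ _ "pt (x - 1)"]) auto
      qed
    qed
  qed
  have perm: "f permutes {..N}"
  proof (rule bij_imp_permutes)
    show "bij_betw f {..N} {..N}"
      using surj by (simp add: bij_betw_def finite_surj_inj)
    show "f x = x" if "x \<notin> {..N}" for x using that by (simp add: f_def)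
  qed
  have f_pow: "(f ^^ i) (pt x) = pt (x + int i)" for i x
    by (induction i) (auto simp: f_pt algebra_simps)
  have cyc: "cyclic_on f ({..N} - {N})"
  proof -
    have "orbit f (pt 0) = {..<N}"
    proof
      show "orbit f (pt 0) \<subseteq> {..<N}" by (auto simp: orbit_altdef f_pow pt_lt)
      show "{..<N} \<subseteq> orbit f (pt 0)"
      proof
        fix i assume "i \<in> {..<N}"
        then have "i < N" by simp
        then have "i = pt (int i)" by (simp add: pt_def N_def)
        \<comment> \<open>\<open>orbit\<close> collects positive iterates only, so a full turn is
          added to reach \<open>pt 0\<close> as well.\<close>
        also have "\<dots> = pt (int i + n)" by (simp add: pt_def)
        also have "int i + n = 0 + int (i + N)" using n0 by (simp add: N_def)
        also have "pt (0 + int (i + N)) = (f ^^ (i + N)) (pt 0)" by (simp only: f_pow)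
        finally show "i \<in> orbit f (pt 0)" using n0 unfolding orbit_altdef N_def
          by (intro CollectI exI[of _ "i + nat n"]) auto
      qed
    qed
    moreover have "{..N} - {N} = {..<N}" by auto
    ultimately show ?thesis unfolding cyclic_on_def using pt_lt[of 0] by (intro bexI[of _ "pt 0"]) auto
  qed
  have T_I: "(b, x, y) \<in> T" if "b \<in> \<F>" "x \<in> b" "y \<in> b" "x \<noteq> y" for b x y
    using that by (simp add: T_def)
  have T_D: "(y - x) mod n \<in> {1..<n} - {q, 2 * q}" if "b \<in> \<F>" "x \<in> b" "y \<in> b" "x \<noteq> y" for b x y
    using bij_betwE[OF exact(1)] T_I[OF that] by (fastforce simp: q_def)
  have inj_pt: "inj_on (\<lambda>x. pt (x + t)) b" if "b \<in> \<F>" for b t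
  proof (rule inj_onI, rule ccontr)
    fix x y assume xy: "x \<in> b" "y \<in> b" "pt (x + t) = pt (y + t)" "x \<noteq> y"
    then have "(y - x) mod n = 0" by (simp add: pt_eq)
    with T_D[OF that xy(1,2,4)] show False by auto
  qed
  have q_not: "\<not> n dvd q" "\<not> n dvd 2 * q" using nq q0 zdvd_imp_le[of n q] zdvd_imp_le[of n "2 * q"] by auto
  have Inf_card: "card (Inf t) = 4" for t
  proof -
    have "pt t \<noteq> pt (t + q)" "pt t \<noteq> pt (t + 2 * q)" "pt (t + q) \<noteq> pt (t + 2 * q)"
      using q_not by (simp_all add: pt_eq)
    then show ?thesis by (simp add: Inf_def pt_ne)
  qed
  have blocks: "B \<subseteq> {..N} \<and> card B = 4" if "B \<in> \<B>" for B
  proof -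
    from that consider b t where "b \<in> \<F>" "B = Fin b t" | t where "B = Inf t" by (auto simp: \<B>_def)
    then show ?thesis
    proof cases
      case 1
      then show ?thesis using pt_lt exact(2) inj_pt
        by (auto simp: Fin_def card_image less_imp_le)
    next
      case 2
      then show ?thesis using Inf_card pt_lt by (auto simp: Inf_def less_imp_le)
    qed
  qed
  have Inf_shift: "Inf (t + q) = Inf t" for t
  proof -
    have "pt (t + 3 * q) = pt t" by (simp add: pt_eq nq)
    then show ?thesis by (auto simp: Inf_def algebra_simps)
  qed
  have Inf_eq: "Inf t = Inf x" if x: "pt x \<in> Inf t" for x t
  proof -
    have cong: "Inf a = Inf b" if "pt a = pt b" for a b
    proof -
      have "pt (a + c) = pt (b + c)" for c using that by (simp add: pt_eq)
      then show ?thesis by (simp add: Inf_def that)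
    qed
    from x have "pt x = pt t \<or> pt x = pt (t + q) \<or> pt x = pt (t + q + q)"
      by (auto simp: Inf_def pt_ne algebra_simps)
    then show ?thesis using cong Inf_shift by metis
  qed
  have Inf_self: "pt x \<in> Inf x" "N \<in> Inf x" for x by (auto simp: Inf_def)
  have in_Fin: "\<exists>u\<in>b. n dvd (x - (u + t))" if "pt x \<in> Fin b t" for x b t
    using that by (auto simp: Fin_def pt_eq dvd_diff_commute)
  have N_Fin: "N \<notin> Fin b t" for b t by (auto simp: Fin_def pt_ne)
  have mod_eqI: "a mod n = b mod n" if "n dvd (a - b)" for a b :: int
    using that by (simp add: mod_eq_dvd_iff)
  have Fin_diff: "(y - x) mod n \<notin> {q, 2 * q}"
    if h: "b \<in> \<F>" "pt x \<in> Fin b t" "pt y \<in> Fin b t" "pt x \<noteq> pt y" for b t x y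
  proof -
    obtain u v where uv: "u \<in> b" "n dvd (x - (u + t))" "v \<in> b" "n dvd (y - (v + t))"
      using in_Fin h(2,3) by blast
    have "n dvd ((y - (v + t)) - (x - (u + t)))" using uv dvd_diff by blast
    then have "n dvd ((y - x) - (v - u))" by (simp add: algebra_simps)
    then have eq: "(y - x) mod n = (v - u) mod n" by (rule mod_eqI)
    have "u \<noteq> v" using eq h(4) by (auto simp: pt_eq)
    then show ?thesis using T_D[OF h(1) uv(1,3)] eq by simp
  qed
  have Fin_unique: "Fin b t = Fin b' t'"
    if b: "b \<in> \<F>" "b' \<in> \<F>" and p: "pt x \<in> Fin b t" "pt y \<in> Fin b t"
      "pt x \<in> Fin b' t'" "pt y \<in> Fin b' t'" and ne: "pt x \<noteq> pt y" for b b' t t' x y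
  proof -
    obtain u v where uv: "u \<in> b" "n dvd (x - (u + t))" "v \<in> b" "n dvd (y - (v + t))"
      using in_Fin p by blast
    obtain u' v' where uv': "u' \<in> b'" "n dvd (x - (u' + t'))" "v' \<in> b'" "n dvd (y - (v' + t'))"
      using in_Fin p by blast
    have "n dvd ((y - (v + t)) - (x - (u + t)))" using uv dvd_diff by blast
    then have "n dvd ((y - x) - (v - u))" by (simp add: algebra_simps)
    then have e1: "(y - x) mod n = (v - u) mod n" by (rule mod_eqI)
    have "n dvd ((y - (v' + t')) - (x - (u' + t')))" using uv' dvd_diff by blast
    then have "n dvd ((y - x) - (v' - u'))" by (simp add: algebra_simps)
    then have e2: "(y - x) mod n = (v' - u') mod n" by (rule mod_eqI)
    have "u \<noteq> v" "u' \<noteq> v'" using e1 e2 ne by (auto simp: pt_eq)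
    \<comment> \<open>Exactness of the cover: both pairs realize the difference
      \<open>y - x\<close>, so they are the same pair of the same base block. Comparing the
      positions of \<open>x\<close> then identifies \<open>t\<close> and \<open>t'\<close> modulo
      \<open>n\<close>.\<close>
    then have "(b, u, v) = (b', u', v')"
      using e1 e2 uv uv' b
      by (intro inj_onD[OF bij_betw_imp_inj_on[OF exact(1)]]) (auto intro!: T_I)
    then have same: "b = b'" "u = u'" by auto
    have "n dvd ((x - (u + t)) - (x - (u' + t')))" using uv uv' dvd_diff by blast
    then have "n dvd t' - t" using same by (simp add: algebra_simps)
    then have "pt (z + t) = pt (z + t')" for z by (simp add: pt_eq)
    then show ?thesis by (simp add: Fin_def same)
  qed
  have Fin_ex: "\<exists>b t. b \<in> \<F> \<and> pt x \<in> Fin b t \<and> pt y \<in> Fin b t"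
    if "(y - x) mod n \<in> {1..<n} - {q, 2 * q}" for x y
  proof -
    have "(y - x) mod n \<in> (\<lambda>(b, x, y). (y - x) mod n) ` T"
      using that exact(1) by (simp add: bij_betw_def q_def)
    then obtain b u v where b: "b \<in> \<F>" "u \<in> b" "v \<in> b" "(y - x) mod n = (v - u) mod n"
      by (auto simp: T_def)
    have "pt x = pt (u + (x - u))" by simp
    moreover have "pt y = pt (v + (x - u))"
      using b(4) by (simp add: pt_eq mod_eq_dvd_iff algebra_simps dvd_diff_commute)
    ultimately show ?thesis using b(1-3) unfolding Fin_def by blast
  qed
  have Inf_ex: "pt y \<in> Inf x" if "(y - x) mod n \<in> {q, 2 * q}" for x y
  proof -
    have "\<exists>c\<in>{q, 2 * q}. n dvd (y - x - c)"
      using that by (metis mod_eq_dvd_iff mod_mod_trivial)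
    then show ?thesis by (auto simp: Inf_def pt_eq algebra_simps dvd_diff_commute)
  qed
  have Inf_diff: "(y - x) mod n \<in> {q, 2 * q}" if "pt x \<in> Inf t" "pt y \<in> Inf t" "pt x \<noteq> pt y" for x y t
  proof -
    have "pt y \<in> Inf x" using Inf_eq that by simp
    then have "pt y = pt (x + q) \<or> pt y = pt (x + 2 * q)" using that(3) by (auto simp: Inf_def pt_ne)
    then have "n dvd (y - x) - q \<or> n dvd (y - x) - 2 * q"
      by (auto simp: pt_eq algebra_simps dvd_diff_commute)
    then have "(y - x) mod n = q mod n \<or> (y - x) mod n = 2 * q mod n" using mod_eqI by blast
    then show ?thesis using nq q0 by auto
  qed
  have pairs: "\<exists>!B. B \<in> \<B> \<and> pt x \<in> B \<and> pt y \<in> B" if ne: "pt x \<noteq> pt y" for x y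
  proof (cases "(y - x) mod n \<in> {q, 2 * q}")
    case True
    show ?thesis
    proof (rule ex1I[of _ "Inf x"])
      show "Inf x \<in> \<B> \<and> pt x \<in> Inf x \<and> pt y \<in> Inf x"
        using Inf_ex[OF True] Inf_self by (simp add: \<B>_def)
      fix B assume B: "B \<in> \<B> \<and> pt x \<in> B \<and> pt y \<in> B"
      then show "B = Inf x" using Fin_diff[of _ x _ y] ne True Inf_eq unfolding \<B>_def by blast
    qed
  next
    case False
    have "(y - x) mod n \<noteq> 0" using ne by (auto simp: pt_eq)
    then have "(y - x) mod n \<in> {1..<n} - {q, 2 * q}" using False n0 pos_mod_sign[of n "y - x"]
      by (auto simp: order_le_less)
    from Fin_ex[OF this] obtain b t where b: "b \<in> \<F>" "pt x \<in> Fin b t" "pt y \<in> Fin b t" by blast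
    show ?thesis
    proof (rule ex1I[of _ "Fin b t"])
      show "Fin b t \<in> \<B> \<and> pt x \<in> Fin b t \<and> pt y \<in> Fin b t" using b by (auto simp: \<B>_def)
      fix B assume B: "B \<in> \<B> \<and> pt x \<in> B \<and> pt y \<in> B"
      then show "B = Fin b t"
        using Inf_diff[of x _ y] ne False Fin_unique[OF _ b(1), of _ x _ y t] b unfolding \<B>_def by blast
    qed
  qed
  have pairsN: "\<exists>!B. B \<in> \<B> \<and> pt x \<in> B \<and> N \<in> B" for x
  proof (rule ex1I[of _ "Inf x"])
    show "Inf x \<in> \<B> \<and> pt x \<in> Inf x \<and> N \<in> Inf x" using Inf_self by (simp add: \<B>_def)
    fix B assume "B \<in> \<B> \<and> pt x \<in> B \<and> N \<in> B"
    then show "B = Inf x" using N_Fin Inf_eq unfolding \<B>_def by blast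
  qed
  have "steiner_system_2 4 (nat n + 1) {..N} \<B>"
    unfolding steiner_system_2_def
  proof (intro conjI ballI impI)
    show "card {..N} = nat n + 1" by (simp add: N_def)
    fix x y assume "x \<in> {..N}" "y \<in> {..N}" and ne: "x \<noteq> y"
    then consider "x = N" "\<exists>a. y = pt a" | "y = N" "\<exists>a. x = pt a"
      | "\<exists>a. x = pt a" "\<exists>a. y = pt a"
      using pt_surj by (auto simp: order_le_less)
    then show "\<exists>!B. B \<in> \<B> \<and> x \<in> B \<and> y \<in> B"
    proof cases
      case 1
      then obtain a where "x = N" "y = pt a" by blast
      then show ?thesis using pairsN[of a] by (simp only: conj_commute)
    next
      case 2
      then show ?thesis using pairsN by blast
    next
      case 3
      then show ?thesis using pairs ne by blast
    qed
  qed (use blocks in auto)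
  then have "one_rotational_steiner_system_2 4 (nat n + 1) {..N} \<B>"
    unfolding one_rotational_steiner_system_2_def design_automorphism_def
    using perm aut cyc f_N by auto
  then show ?thesis by blast
qed

section \<open>Linear families of base blocks\<close>

text \<open>
  A triple \<open>(a, b, s)\<close> stands for the number \<open>a m + b + s i\<close>, linear in a size parameter \<open>m\<close> and in
  the index \<open>i < m\<close> of a block within its family.
\<close>

type_synonym linear_point = "int \<times> int \<times> int"

definition point_at :: "int \<Rightarrow> int \<Rightarrow> linear_point \<Rightarrow> int" where
  "point_at m i = (\<lambda>(a, b, s). a * m + b + s * i)"

fun linear_differences :: "linear_point list \<Rightarrow> linear_point list" where
  "linear_differences [] = []"
| "linear_differences ((a, b, s) # ps) =
     map (\<lambda>(a', b', s'). (a - a', b - b', s - s')) ps @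
     map (\<lambda>(a', b', s'). (a' - a, b' - b, s' - s)) ps @ linear_differences ps"

text \<open>
  Modulo \<open>n = 12 (6 m + c) + 3\<close>, the coefficient of \<open>m\<close> only matters modulo 72; a progression
  with negative step is traversed backwards from \<open>i = m - 1\<close>.
\<close>

definition normalize_point :: "int \<Rightarrow> linear_point \<Rightarrow> linear_point" where
  "normalize_point c = (\<lambda>(a, b, s).
     let a' = (if s < 0 then a + s else a); b' = (if s < 0 then b - s else b)
     in (a' mod 72, b' - a' div 72 * (12 * c + 3), \<bar>s\<bar>))"

text \<open>
  Started at \<open>(a, b)\<close>, \<open>chain\<close> returns a pair \<open>(a', b')\<close> such that the progressions consumed on the way
  fill the interval from \<open>a m + b\<close> to \<open>a' m + b' - 1\<close> for every \<open>m\<close>.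
\<close>

fun chain :: "linear_point list \<Rightarrow> int \<times> int \<Rightarrow> int \<times> int" where
  "chain [] p = p"
| "chain ((a', b', s) # L) (a, b) =
     (if (a', b') \<noteq> (a, b) then (a, b)
      else if s = 0 then chain L (a, b + 1)
      else if s = 1 then chain L (a + 1, b)
      else if s = 2 \<and> take 1 L = [(a, b + 1, 2)] then chain (drop 1 L) (a + 2, b)
      else if s = 3 \<and> take 2 L = [(a, b + 1, 3), (a, b + 2, 3)] then chain (drop 2 L) (a + 3, b)
      else (a, b))"

text \<open>A triple of step 0 stands for a single number and is available even when
  \<open>m = 0\<close>; any other triple stands for a progression of \<open>m\<close> terms.\<close>

definition represented :: "int \<Rightarrow> linear_point list \<Rightarrow> int \<Rightarrow> bool" where
  "represented m L d \<longleftrightarrow> (\<exists>a b s i. (a, b, s) \<in> set L \<and> d = a * m + b + s * i \<and>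
     (if s = 0 then i = 0 else 0 \<le> i \<and> i < m))"

text \<open>The remainder of the offset of \<open>d\<close> modulo \<open>s\<close> selects one of
  the \<open>s\<close> interleaved progressions, the quotient selects the term in it.\<close>

lemma represented_step:
  assumes "s > 0" and "\<And>j. 0 \<le> j \<Longrightarrow> j < s \<Longrightarrow> (a, b + j, s) \<in> set L"
    and d: "a * m + b \<le> d" "d < (a + s) * m + b"
  shows "represented m L d"
proof -
  let ?e = "d - (a * m + b)"
  have e: "0 \<le> ?e" "?e < s * m" using d by (auto simp: algebra_simps)
  have "s * (?e div s) \<le> ?e"
    using mult_div_mod_eq[of s ?e] pos_mod_sign[of s ?e] assms(1) by linarith
  then have "s * (?e div s) < s * m" using e by linarith
  then have "?e div s < m" using assms(1) by simp
  moreover have "0 \<le> ?e div s" using e assms(1) by (simp add: pos_imp_zdiv_nonneg_iff)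
  moreover have "(a, b + ?e mod s, s) \<in> set L" using assms by simp
  moreover have "d = a * m + (b + ?e mod s) + s * (?e div s)"
    using mult_div_mod_eq[of s ?e] by linarith
  ultimately show ?thesis unfolding represented_def using assms(1)
    by (intro exI[of _ a] exI[of _ "b + ?e mod s"] exI[of _ s] exI[of _ "?e div s"]) simp
qed

lemma represented_mono: "represented m L d \<Longrightarrow> set L \<subseteq> set L' \<Longrightarrow> represented m L' d"
  unfolding represented_def by blast

text \<open>Induction along \<open>chain\<close>: \<open>d\<close> lies either in the piece consumed
  first or in the interval filled by the rest.\<close>

lemma chain_represented:
  assumes "m \<ge> 0" "chain L (a, b) = (a', b')" "a * m + b \<le> d" "d < a' * m + b'"
  shows "represented m L d"
  using assms
proof (induction L "(a, b)" arbitrary: a b rule: chain.induct)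
  case 1
  then show ?case by simp
next
  case (2 a1 b1 s L a b)
  let ?L = "(a1, b1, s) # L"
  \<comment> \<open>On a mismatch \<open>chain\<close> would stop where it started, leaving an empty
    interval and no room for \<open>d\<close>.\<close>
  have start: "(a1, b1) = (a, b)" using "2.prems" by (auto split: if_splits)
  have drop: "set (drop k L) \<subseteq> set ?L" for k by (meson set_drop_subset set_subset_Cons subset_trans)
  have take: "set (take k L) \<subseteq> set ?L" for k by (meson set_take_subset set_subset_Cons subset_trans)
  consider (zero) "s = 0" | (one) "s = 1" | (two) "s = 2" "take 1 L = [(a, b + 1, 2)]"
    | (three) "s = 3" "take 2 L = [(a, b + 1, 3), (a, b + 2, 3)]"
    using "2.prems" start by (auto split: if_splits)
  then show ?case
  proof cases
    case zero
    show ?thesis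
    proof (cases "d = a * m + b")
      case True
      then show ?thesis using zero start unfolding represented_def
        by (intro exI[of _ a] exI[of _ b] exI[of _ 0]) simp
    next
      case False
      then have "represented m L d" using "2.prems" zero start by (intro "2.hyps"(1)) auto
      then show ?thesis by (rule represented_mono) auto
    qed
  next
    case one
    show ?thesis
    proof (cases "d < (a + 1) * m + b")
      case True
      have "(a, b + j, 1) \<in> set ?L" if "0 \<le> j" "j < 1" for j
      proof -
        have "j = 0" using that by linarith
        then show ?thesis using one start by auto
      qed
      from represented_step[where s = 1, OF _ this "2.prems"(3) True] show ?thesis by simp
    next
      case False
      then have "represented m L d" using "2.prems" one start by (intro "2.hyps"(2)) auto
      then show ?thesis by (rule represented_mono) auto
    qed
  next
    case two
    show ?thesis
    proof (cases "d < (a + 2) * m + b")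
      case True
      have "(a, b + j, 2) \<in> set ?L" if "0 \<le> j" "j < 2" for j
      proof -
        have "j = 0 \<or> j = 1" using that by linarith
        then show ?thesis using two start take[of 1] by auto
      qed
      from represented_step[where s = 2, OF _ this "2.prems"(3) True] show ?thesis by simp
    next
      case False
      then have "represented m (drop 1 L) d" using "2.prems" two start by (intro "2.hyps"(3)) auto
      then show ?thesis by (rule represented_mono) (rule drop)
    qed
  next
    case three
    show ?thesis
    proof (cases "d < (a + 3) * m + b")
      case True
      have "(a, b + j, 3) \<in> set ?L" if "0 \<le> j" "j < 3" for j
      proof -
        have "j = 0 \<or> j = 1 \<or> j = 2" using that by linarith
        then show ?thesis using three start take[of 2] by auto
      qed
      from represented_step[where s = 3, OF _ this "2.prems"(3) True] show ?thesis by simp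
    next
      case False
      then have "represented m (drop 2 L) d" using "2.prems" three start by (intro "2.hyps"(4)) auto
      then show ?thesis by (rule represented_mono) (rule drop)
    qed
  qed
qed

text \<open>The two points are chosen once for all \<open>m\<close> and \<open>i\<close>, so that
  values at different indices can later be compared.\<close>

lemma linear_differences_point_at:
  assumes "(a, b, s) \<in> set (linear_differences ps)"
  shows "\<exists>x\<in>set ps. \<exists>y\<in>set ps. \<forall>m i. point_at m i y - point_at m i x = a * m + b + s * i"
  using assms
proof (induction ps rule: linear_differences.induct)
  case (2 a0 b0 s0 ps)
  then consider "(a, b, s) \<in> (\<lambda>(a', b', s'). (a0 - a', b0 - b', s0 - s')) ` set ps"
    | "(a, b, s) \<in> (\<lambda>(a', b', s'). (a' - a0, b' - b0, s' - s0)) ` set ps"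
    | "(a, b, s) \<in> set (linear_differences ps)"
    unfolding linear_differences.simps set_append set_map Un_iff by blast
  then show ?case
  proof cases
    case 1
    then obtain p where p: "p \<in> set ps" "(a, b, s) = (case p of (a', b', s') \<Rightarrow> (a0 - a', b0 - b', s0 - s'))" by blast
    then show ?thesis
      by (intro bexI[of _ p] bexI[of _ "(a0, b0, s0)"])
         (auto simp: point_at_def algebra_simps split: prod.splits)
  next
    case 2
    then obtain p where p: "p \<in> set ps" "(a, b, s) = (case p of (a', b', s') \<Rightarrow> (a' - a0, b' - b0, s' - s0))" by blast
    then show ?thesis
      by (intro bexI[of _ "(a0, b0, s0)"] bexI[of _ p])
         (auto simp: point_at_def algebra_simps split: prod.splits)
  next
    case 3
    from "2.IH"[OF 3] obtain x y where "x \<in> set ps" "y \<in> set ps"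
      "\<forall>m i. point_at m i y - point_at m i x = a * m + b + s * i" by blast
    then show ?thesis by (intro bexI[of _ x] bexI[of _ y]) simp_all
  qed
qed simp

definition family_differences :: "int \<Rightarrow> linear_point list list \<Rightarrow> linear_point list" where
  "family_differences c Fs = map (normalize_point c) (concat (map linear_differences Fs))"

text \<open>
  The added point \<open>(24, 4 c + 1, 0)\<close> is \<open>n / 3\<close>, which need not be covered; the end point
  \<open>(36, 6 c + 2)\<close> is the successor of \<open>(n - 1) / 2\<close>. Sorting, filtering and truncating only prepare
  the list for \<^const>\<open>chain\<close>, so soundness depends neither on the key \<open>1000 a + b\<close> nor on the length
  \<open>6 c + 37\<close>, the number of points and progressions in the half range.
\<close>

definition difference_certificate :: "int \<Rightarrow> linear_point list list \<Rightarrow> linear_point list list \<Rightarrow> bool" where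
  "difference_certificate c Rs Is \<longleftrightarrow>
     length Rs = 6 \<and> int (length Is) = c \<and>
     list_all (\<lambda>F. length F = 4) (Rs @ Is) \<and> list_all (list_all (\<lambda>(a, b, s). s = 0)) Is \<and>
     list_all (\<lambda>(a, b, s). s \<noteq> 0) (concat (map linear_differences Rs)) \<and>
     chain (take (6 * length Is + 37) (sort_key (\<lambda>(a, b, s). 1000 * a + b)
       (filter (\<lambda>(a, b, s). a \<le> 36 \<and> 0 < b)
         ((24, 4 * c + 1, 0) # family_differences c (Rs @ Is))))) (0, 1) = (36, 6 * c + 2)"

text \<open>The blocks of \<open>Is\<close> have step 0 in a certificate, so the single index 0
  stands for all of them.\<close>

definition certificate_blocks ::
    "linear_point list list \<Rightarrow> linear_point list list \<Rightarrow> nat \<Rightarrow> int set set" where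
  "certificate_blocks Rs Is m =
     (\<lambda>(F, i). point_at (int m) (int i) ` set F) ` (set Rs \<times> {..<m} \<union> set Is \<times> {0})"

text \<open>\<open>chain\<close> exhibits \<open>d\<close> as a term of a normalized progression.
  Undoing the normalization changes the value by a multiple of \<open>n\<close> and possibly
  reverses the index, so \<open>d\<close> is congruent to a difference inside an actual
  block.\<close>

lemma difference_certificate_covers:
  assumes cert: "difference_certificate c Rs Is"
    and n: "n = 12 * (6 * int m + c) + 3"
    and d: "1 \<le> d" "d \<le> 6 * (6 * int m + c) + 1" "d \<noteq> 4 * (6 * int m + c) + 1"
  shows "covers_differences n (certificate_blocks Rs Is m) d"
proof -
  let ?L = "(24, 4 * c + 1, 0) # family_differences c (Rs @ Is)"
  let ?S = "take (6 * length Is + 37) (sort_key (\<lambda>(a, b, s). 1000 * a + b)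
    (filter (\<lambda>(a, b, s). a \<le> 36 \<and> 0 < b) ?L))"
  have "represented (int m) ?S d"
    by (rule chain_represented[where a = 0 and b = 1 and a' = 36 and b' = "6 * c + 2"])
       (use cert d in \<open>auto simp: difference_certificate_def\<close>)
  moreover have "set (take k (sort_key f (filter P xs))) \<subseteq> set xs"
    for k P and f :: "linear_point \<Rightarrow> int" and xs
    by (auto dest!: in_set_takeD)
  ultimately have "represented (int m) ?L d" by (rule represented_mono)
  then obtain a b s i where *: "(a, b, s) \<in> set ?L" "d = a * int m + b + s * i"
    "if s = 0 then i = 0 else 0 \<le> i \<and> i < int m"
    unfolding represented_def by blast
  \<comment> \<open>The added entry has the value \<open>n div 3\<close>, which \<open>d\<close>
    avoids by assumption; hence the entry found comes from a block.\<close>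
  have "(a, b, s) \<noteq> (24, 4 * c + 1, 0)" using * d by auto
  with * obtain F a0 b0 s0 where F: "F \<in> set (Rs @ Is)" "(a0, b0, s0) \<in> set (linear_differences F)"
    "(a, b, s) = normalize_point c (a0, b0, s0)"
    unfolding family_differences_def by (fastforce split: prod.splits)
  \<comment> \<open>Normalization reverses a progression of negative step; \<open>i0\<close> is the
    index in the original one.\<close>
  define i0 where "i0 = (if s0 < 0 then int m - 1 - i else i)"
  have s: "s = \<bar>s0\<bar>" using F(3) by (simp add: normalize_point_def Let_def)
  have shift: "((72 * q + e) * M + r) - (e * M + (r - q * W)) = q * (72 * M + W)" for q e r M W :: int
    by (simp add: algebra_simps)
  have red: "(p * int m + r) - ((p mod 72) * int m + (r - p div 72 * (12 * c + 3))) = p div 72 * n" for p r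
  proof -
    have "n = 72 * int m + (12 * c + 3)" unfolding n by simp
    then show ?thesis using shift[of "p div 72" "p mod 72" "int m" r "12 * c + 3"] by simp
  qed
  have "n dvd (a0 * int m + b0 + s0 * i0) - d"
  proof (cases "s0 < 0")
    case True
    then have "a = (a0 + s0) mod 72" "b = b0 - s0 - (a0 + s0) div 72 * (12 * c + 3)"
      using F(3) by (simp_all add: normalize_point_def Let_def)
    then have "(a0 * int m + b0 + s0 * i0) - d = (a0 + s0) div 72 * n"
      using *(2) s True red[of "a0 + s0" "b0 - s0"] by (simp add: i0_def algebra_simps)
    then show ?thesis by simp
  next
    case False
    then have "a = a0 mod 72" "b = b0 - a0 div 72 * (12 * c + 3)"
      using F(3) by (simp_all add: normalize_point_def Let_def)
    then have "(a0 * int m + b0 + s0 * i0) - d = a0 div 72 * n"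
      using *(2) s False red[of a0 b0] by (simp add: i0_def algebra_simps)
    then show ?thesis by simp
  qed
  then have cong: "[a0 * int m + b0 + s0 * i0 = d] (mod n)" by (simp add: cong_iff_dvd_diff)
  obtain x y where xy: "x \<in> set F" "y \<in> set F"
    "\<And>m i. point_at m i y - point_at m i x = a0 * m + b0 + s0 * i"
    using linear_differences_point_at[OF F(2)] by blast
  \<comment> \<open>Only the product with \<open>s0\<close> matters. In a family the step is
    nonzero, so \<open>i0\<close> is in range; in a block of \<open>Is\<close> the step is zero and
    the index 0 serves.\<close>
  have "\<exists>B\<in>certificate_blocks Rs Is m. \<exists>i1. B = point_at (int m) i1 ` set F \<and> s0 * i1 = s0 * i0"
  proof (cases "F \<in> set Rs")
    case True
    then have "s0 \<noteq> 0" using cert F(2) unfolding difference_certificate_def list_all_iff by fastforce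
    then have "0 \<le> i0 \<and> i0 < int m" using *(3) s by (auto simp: i0_def)
    then have "int (nat i0) = i0" "nat i0 < m" by auto
    then show ?thesis using True unfolding certificate_blocks_def
      by (intro bexI[of _ "point_at (int m) i0 ` set F"] image_eqI[of _ _ "(F, nat i0)"]) auto
  next
    case False
    then have FI: "F \<in> set Is" using F(1) by simp
    then have z: "\<forall>(a, b, s)\<in>set F. s = 0" using cert unfolding difference_certificate_def list_all_iff by blast
    \<comment> \<open>Comparing the indices 0 and 1 at \<open>m = 0\<close> isolates the step
      \<open>s0\<close>.\<close>
    have "point_at 0 1 w = point_at 0 0 w" if "w \<in> set F" for w
      using z that by (auto simp: point_at_def)
    then have "s0 = 0" using xy(3)[of 0 0] xy(3)[of 0 1] xy(1,2) by simp
    then show ?thesis using FI unfolding certificate_blocks_def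
      by (intro bexI[of _ "point_at (int m) 0 ` set F"] image_eqI[of _ _ "(F, 0)"] exI[of _ 0]) auto
  qed
  then obtain B i1 where B: "B \<in> certificate_blocks Rs Is m" "B = point_at (int m) i1 ` set F" "s0 * i1 = s0 * i0"
    by blast
  then show ?thesis unfolding covers_differences_def using xy cong
    by (intro bexI[of _ B] bexI[of _ "point_at (int m) i1 x"] bexI[of _ "point_at (int m) i1 y"]) auto
qed

lemma difference_certificate_one_rotational:
  assumes cert: "difference_certificate c Rs Is"
  shows "\<exists>(X :: nat set) \<B>. one_rotational_steiner_system_2 4 (nat (12 * (6 * int m + c) + 4)) X \<B>"
proof -
  let ?k = "6 * int m + c" and ?\<F> = "certificate_blocks Rs Is m"
  have c: "c \<ge> 0" "length Rs = 6" "length Is = nat c" using cert by (auto simp: difference_certificate_def)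
  have "\<exists>(X :: nat set) \<B>. one_rotational_steiner_system_2 4 (nat (12 * ?k + 3) + 1) X \<B>"
  proof (rule one_rotational_of_difference_cover[OF refl])
    show "finite ?\<F>" unfolding certificate_blocks_def by simp
    have "card ?\<F> \<le> card (set Rs \<times> {..<m} \<union> set Is \<times> {0::nat})"
      unfolding certificate_blocks_def by (intro card_image_le) simp
    also have "\<dots> \<le> card (set Rs) * m + card (set Is)"
      using card_Un_le[of "set Rs \<times> {..<m}" "set Is \<times> {0::nat}"] by (simp add: card_cartesian_product)
    also have "\<dots> \<le> 6 * m + nat c"
      using card_length[of Rs] card_length[of Is] c by (intro add_mono mult_mono) auto
    finally show "card ?\<F> \<le> nat ?k" using c by (simp add: nat_add_distrib nat_mult_distrib)
    fix B assume "B \<in> ?\<F>"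
    then obtain F i where F: "F \<in> set (Rs @ Is)" "B = point_at (int m) i ` set F"
      unfolding certificate_blocks_def by auto
    then have "length F = 4" using cert unfolding difference_certificate_def list_all_iff by blast
    then show "finite B \<and> card B \<le> 4"
      using F(2) card_image_le[of "set F" "point_at (int m) i"] card_length[of F] by auto
  qed (use c difference_certificate_covers[OF cert refl] in auto)
  moreover have "nat (12 * ?k + 3) + 1 = nat (12 * ?k + 4)" using c by simp
  ultimately show ?thesis by simp
qed

section \<open>Certificates for the six residue classes of k modulo 6\<close>

text \<open>The check does not involve \<open>m\<close>, so one evaluation settles every
  \<open>k = 6 * m + 6\<close>. The next five certificates treat the other residues; at
  \<open>m = 0\<close> the single blocks alone serve \<open>k\<close> from 6 to 11.\<close>

lemma certificate_6: "difference_certificate 6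
  [[(0, 0, 0), (7, 8, 1), (44, 48, 2), (0, 3, 3)],
   [(0, 0, 0), (10, 12, 1), (49, 54, 2), (0, 4, 3)],
   [(0, 0, 0), (18, 19, 1), (21, 24, 2), (0, 2, 3)],
   [(0, 0, 0), (4, 5, 1), (46, 50, 2), (12, 16, 3)],
   [(0, 0, 0), (11, 13, 1), (26, 30, 2), (57, 64, 3)],
   [(0, 0, 0), (19, 21, 1), (54, 59, 2), (12, 15, 3)]]
  [[(0, 0, 0), (0, 1, 0), (-31, -32, 0), (-19, -19, 0)],
   [(0, 0, 0), (8, 8, 0), (-23, -23, 0), (-8, -9, 0)],
   [(0, 0, 0), (7, 7, 0), (33, 34, 0), (-28, -29, 0)],
   [(0, 0, 0), (3, 2, 0), (-26, -28, 0), (-23, -24, 0)],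
   [(0, 0, 0), (3, 3, 0), (-34, -35, 0), (18, 18, 0)],
   [(0, 0, 0), (5, 5, 0), (-15, -16, 0), (-5, -6, 0)]]"
  by code_simp

lemma certificate_7: "difference_certificate 7
  [[(0, 0, 0), (13, 16, 1), (16, 20, 2), (69, 86, 3)],
   [(0, 0, 0), (22, 28, 1), (33, 43, 2), (0, 5, 3)],
   [(0, 0, 0), (24, 30, 1), (28, 35, 2), (69, 87, 3)],
   [(0, 0, 0), (8, 11, 1), (20, 26, 2), (64, 80, 3)],
   [(0, 0, 0), (10, 13, 1), (33, 42, 2), (64, 81, 3)],
   [(0, 0, 0), (19, 24, 1), (28, 36, 2), (64, 82, 3)]]
  [[(0, 0, 0), (5, 5, 0), (-13, -15, 0), (-5, -7, 0)],
   [(0, 0, 0), (4, 4, 0), (-23, -28, 0), (-14, -17, 0)],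
   [(0, 0, 0), (0, 2, 0), (-27, -31, 0), (-22, -25, 0)],
   [(0, 0, 0), (0, 1, 0), (-31, -36, 0), (8, 10, 0)],
   [(0, 0, 0), (11, 13, 0), (30, 35, 0), (-28, -34, 0)],
   [(0, 0, 0), (3, 3, 0), (-33, -39, 0), (-19, -23, 0)],
   [(0, 0, 0), (11, 14, 0), (31, 38, 0), (-25, -30, 0)]]"
  by code_simp

lemma certificate_8: "difference_certificate 8
  [[(0, 0, 0), (4, 7, 1), (56, 80, 2), (69, 98, 3)],
   [(0, 0, 0), (12, 18, 1), (46, 67, 2), (0, 5, 3)],
   [(0, 0, 0), (16, 23, 1), (39, 56, 2), (0, 3, 3)],
   [(0, 0, 0), (3, 5, 1), (24, 35, 2), (42, 62, 3)],
   [(0, 0, 0), (17, 25, 1), (7, 12, 2), (27, 41, 3)],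
   [(0, 0, 0), (22, 33, 1), (63, 90, 2), (27, 42, 3)]]
  [[(0, 0, 0), (0, 2, 0), (-27, -37, 0), (-9, -11, 0)],
   [(0, 0, 0), (4, 6, 0), (-26, -34, 0), (-14, -19, 0)],
   [(0, 0, 0), (14, 18, 0), (34, 46, 0), (-22, -32, 0)],
   [(0, 0, 0), (0, 1, 0), (-33, -44, 0), (-3, -3, 0)],
   [(0, 0, 0), (5, 7, 0), (-22, -31, 0), (12, 17, 0)],
   [(0, 0, 0), (5, 8, 0), (14, 20, 0), (-12, -16, 0)],
   [(0, 0, 0), (7, 9, 0), (-31, -43, 0), (-10, -14, 0)],
   [(0, 0, 0), (4, 5, 0), (-22, -30, 0), (20, 27, 0)]]"
  by code_simp

lemma certificate_9: "difference_certificate 9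
  [[(0, 0, 0), (6, 10, 1), (43, 68, 2), (69, 109, 3)],
   [(0, 0, 0), (9, 15, 1), (48, 76, 2), (0, 4, 3)],
   [(0, 0, 0), (15, 25, 1), (27, 44, 2), (69, 111, 3)],
   [(0, 0, 0), (3, 6, 1), (13, 23, 2), (51, 83, 3)],
   [(0, 0, 0), (5, 9, 1), (30, 49, 2), (18, 33, 3)],
   [(0, 0, 0), (21, 34, 1), (16, 28, 2), (51, 82, 3)]]
  [[(0, 0, 0), (9, 13, 0), (-18, -30, 0), (18, 27, 0)],
   [(0, 0, 0), (0, 2, 0), (-32, -48, 0), (7, 12, 0)],
   [(0, 0, 0), (3, 5, 0), (-27, -41, 0), (-15, -24, 0)],
   [(0, 0, 0), (3, 3, 0), (-27, -42, 0), (21, 31, 0)],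
   [(0, 0, 0), (0, 1, 0), (-16, -25, 0), (-13, -21, 0)],
   [(0, 0, 0), (5, 8, 0), (26, 40, 0), (-24, -36, 0)],
   [(0, 0, 0), (5, 7, 0), (12, 18, 0), (-10, -16, 0)],
   [(0, 0, 0), (4, 6, 0), (-32, -49, 0), (10, 15, 0)],
   [(0, 0, 0), (13, 19, 0), (34, 52, 0), (-25, -39, 0)]]"
  by code_simp

lemma certificate_10: "difference_certificate 10
  [[(0, 0, 0), (3, 7, 1), (56, 98, 2), (69, 123, 3)],
   [(0, 0, 0), (6, 13, 1), (41, 74, 2), (0, 5, 3)],
   [(0, 0, 0), (16, 28, 1), (25, 45, 2), (0, 4, 3)],
   [(0, 0, 0), (7, 14, 1), (50, 88, 2), (32, 58, 3)],
   [(0, 0, 0), (8, 15, 1), (60, 104, 2), (37, 67, 3)],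
   [(0, 0, 0), (12, 22, 1), (60, 105, 2), (32, 60, 3)]]
  [[(0, 0, 0), (4, 7, 0), (-27, -44, 0), (10, 19, 0)],
   [(0, 0, 0), (0, 1, 0), (-28, -48, 0), (-18, -31, 0)],
   [(0, 0, 0), (0, 2, 0), (-32, -55, 0), (17, 30, 0)],
   [(0, 0, 0), (3, 4, 0), (-20, -36, 0), (17, 29, 0)],
   [(0, 0, 0), (6, 11, 0), (-31, -53, 0), (-23, -39, 0)],
   [(0, 0, 0), (4, 8, 0), (-32, -54, 0), (13, 24, 0)],
   [(0, 0, 0), (3, 3, 0), (-25, -43, 0), (-13, -23, 0)],
   [(0, 0, 0), (7, 13, 0), (19, 34, 0), (-13, -22, 0)],
   [(0, 0, 0), (3, 6, 0), (-16, -27, 0), (-6, -9, 0)],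
   [(0, 0, 0), (3, 5, 0), (-28, -47, 0), (-22, -37, 0)]]"
  by code_simp

lemma certificate_11: "difference_certificate 11
  [[(0, 0, 0), (3, 7, 1), (56, 108, 2), (69, 134, 3)],
   [(0, 0, 0), (6, 14, 1), (41, 81, 2), (0, 5, 3)],
   [(0, 0, 0), (16, 31, 1), (25, 50, 2), (0, 3, 3)],
   [(0, 0, 0), (7, 15, 1), (50, 96, 2), (32, 64, 3)],
   [(0, 0, 0), (8, 16, 1), (60, 115, 2), (37, 73, 3)],
   [(0, 0, 0), (12, 23, 1), (60, 114, 2), (32, 63, 3)]]
  [[(0, 0, 0), (3, 4, 0), (-32, -59, 0), (31, 58, 0)],
   [(0, 0, 0), (4, 7, 0), (-25, -48, 0), (-18, -34, 0)],
   [(0, 0, 0), (0, 2, 0), (-14, -26, 0), (10, 21, 0)],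
   [(0, 0, 0), (3, 3, 0), (-32, -61, 0), (27, 49, 0)],
   [(0, 0, 0), (16, 29, 0), (35, 65, 0), (-20, -39, 0)],
   [(0, 0, 0), (0, 1, 0), (-31, -56, 0), (6, 13, 0)],
   [(0, 0, 0), (6, 10, 0), (-22, -42, 0), (-14, -27, 0)],
   [(0, 0, 0), (4, 9, 0), (-28, -53, 0), (17, 32, 0)],
   [(0, 0, 0), (3, 5, 0), (-20, -38, 0), (-16, -30, 0)],
   [(0, 0, 0), (3, 6, 0), (9, 17, 0), (-9, -16, 0)],
   [(0, 0, 0), (10, 20, 0), (23, 44, 0), (-22, -40, 0)]]"
  by code_simp

section \<open>Base blocks for small k\<close>

definition small_certificate :: "int \<Rightarrow> int list list \<Rightarrow> bool" where
  "small_certificate k bs \<longleftrightarrow>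
     k \<ge> 0 \<and> int (length bs) = k \<and> list_all (\<lambda>b. length b = 4) bs \<and>
     set (filter (\<lambda>d. d \<noteq> 4 * k + 1) [1..6 * k + 1])
       \<subseteq> set (concat (map (\<lambda>b. concat (map (\<lambda>x. map (\<lambda>y. (y - x) mod (12 * k + 3)) b) b)) bs))"

lemma small_certificate_one_rotational:
  assumes cert: "small_certificate k bs"
  shows "\<exists>(X :: nat set) \<B>. one_rotational_steiner_system_2 4 (nat (12 * k + 4)) X \<B>"
proof -
  have k: "k \<ge> 0" "length bs = nat k" and len: "\<And>b. b \<in> set bs \<Longrightarrow> length b = 4"
    using cert by (auto simp: small_certificate_def list_all_iff)
  have "\<exists>(X :: nat set) \<B>. one_rotational_steiner_system_2 4 (nat (12 * k + 3) + 1) X \<B>"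
  proof (rule one_rotational_of_difference_cover[OF refl k(1)])
    show "finite (set ` set bs)" by simp
    show "card (set ` set bs) \<le> nat k"
      using card_image_le[of "set bs" set] card_length[of bs] k(2) by simp
    fix b assume "b \<in> set ` set bs"
    then obtain xs where "xs \<in> set bs" "b = set xs" by blast
    then show "finite b \<and> card b \<le> 4" using len[of xs] card_length[of xs] by simp
  next
    fix d assume "1 \<le> d" "d \<le> 6 * k + 1" "d \<noteq> 4 * k + 1"
    then have "d \<in> set (filter (\<lambda>d. d \<noteq> 4 * k + 1) [1..6 * k + 1])" by simp
    then have "d \<in> set (concat (map (\<lambda>b. concat (map (\<lambda>x. map (\<lambda>y. (y - x) mod (12 * k + 3)) b) b)) bs))"
      using cert unfolding small_certificate_def by blast
    then obtain b x y where "b \<in> set bs" "x \<in> set b" "y \<in> set b" "d = (y - x) mod (12 * k + 3)"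
      by auto
    then show "covers_differences (12 * k + 3) (set ` set bs) d"
      unfolding covers_differences_def by (auto simp: cong_def)
  qed
  moreover have "nat (12 * k + 3) + 1 = nat (12 * k + 4)" using k(1) by simp
  ultimately show ?thesis by simp
qed

text \<open>The values of \<open>k\<close> below 6. The absent \<open>k = 2\<close> would give
  \<open>v = 28\<close>; for \<open>k = 0\<close> the only block is the one through the fixed
  point.\<close>

lemma small_certificate_values:
  "small_certificate 0 []"
  "small_certificate 1 [[0, 1, 3, 7]]"
  "small_certificate 3 [[0, 15, 19, 22], [0, 16, 18, 28], [0, 8, 9, 14]]"
  "small_certificate 4 [[0, 2, 25, 43], [0, 24, 30, 37], [0, 19, 22, 31], [0, 11, 15, 16]]"
  "small_certificate 5
     [[0, 11, 31, 36], [0, 24, 30, 40], [0, 14, 22, 29], [0, 2, 28, 46], [0, 1, 4, 13]]"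
  by code_simp+

section \<open>Necessary conditions\<close>

definition block_differences :: "int \<Rightarrow> int \<Rightarrow> int \<Rightarrow> int \<Rightarrow> int list" where
  "block_differences a b c d =
     map (\<lambda>x. x mod 27)
       [b - a, a - b, c - a, a - c, d - a, a - d, c - b, b - c, d - b, b - d, d - c, c - d]"

text \<open>Only the difference lists of the quadruples are kept, since the search compares nothing
  else. \<open>x < y\<close> removes the symmetry between the last two points;
  \<open>distinct\<close> discards repeated differences and with them repeated points, which would
  give 0 twice.\<close>

definition blocks_from :: "int \<Rightarrow> int list \<Rightarrow> int list list" where
  "blocks_from e S = filter distinct
     (concat (map (\<lambda>x. map (block_differences 0 e x) (filter (\<lambda>y. x < y) S)) S))"

lemma blocks_from_memI:
  assumes "x \<in> set S" "y \<in> set S" "x < y" "distinct (block_differences 0 e x y)"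
  shows "block_differences 0 e x y \<in> set (blocks_from e S)"
  using assms by (auto simp: blocks_from_def)

text \<open>
  For \<open>n = 27\<close> there would be two classes of quadruples: one has a member through 0 and 1, and the other a
  member through 0 and \<open>e\<close>, where \<open>e\<close> is the least difference not used by the first.
\<close>

definition remaining :: "int list \<Rightarrow> int list" where
  "remaining D = filter (\<lambda>d. d \<notin> set D)
     [1,2,3,4,5,6,7,8,10,11,12,13,14,15,16,17,19,20,21,22,23,24,25,26]"

text \<open>A further point \<open>z\<close> of a block through 0 and \<open>hd R\<close> yields the
  differences \<open>z\<close> and \<open>z - hd R\<close>. Requiring both to be free prunes the
  candidates before full lists are formed.\<close>

definition extensions :: "int list \<Rightarrow> int list list" where
  "extensions R = filter (\<lambda>E. set E \<subseteq> set R)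
     (blocks_from (hd R) (filter (\<lambda>z. (z - hd R) mod 27 \<in> set R) R))"

text \<open>The first block passes through 0 and 1, which leaves \<open>[2..26]\<close> for its
  other points. Testing 9 excludes 18 as well, because the lists are closed under negation modulo
  27.\<close>

lemma no_two_blocks_mod_27:
  "list_all (\<lambda>D. extensions (remaining D) = []) (filter (\<lambda>D. 9 \<notin> set D) (blocks_from 1 [2..26]))"
  by code_simp

text \<open>
  The blocks of a 1-rotational system, with the fixed point deleted and the cycle unrolled:
  \<open>\<C>\<close> consists of unions of residue classes modulo \<open>n\<close>.
\<close>

locale rotational_lines =
  fixes n :: int and \<C> :: "int set set"
  assumes n_pos: "n > 0"
    and periodic: "C \<in> \<C> \<Longrightarrow> x \<in> C \<Longrightarrow> n dvd y - x \<Longrightarrow> y \<in> C"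
    and size: "C \<in> \<C> \<Longrightarrow> card (C \<inter> {0..<n}) \<in> {3, 4}"
    and line: "\<not> n dvd y - x \<Longrightarrow> \<exists>!C. C \<in> \<C> \<and> x \<in> C \<and> y \<in> C"
    and shift: "C \<in> \<C> \<Longrightarrow> {x. x - t \<in> C} \<in> \<C>"
    and triple: "\<exists>!C. C \<in> \<C> \<and> x \<in> C \<and> card (C \<inter> {0..<n}) = 3"
begin

section \<open>Translates and difference sets of lines\<close>

definition translate :: "int \<Rightarrow> int set \<Rightarrow> int set" where
  "translate t C = {x. x - t \<in> C}"

definition residues_of :: "int set \<Rightarrow> int set" where
  "residues_of C = C \<inter> {0..<n}"

text \<open>Lines are unions of residue classes, so \<open>x + d\<close> needs no reduction modulo
  \<open>n\<close>.\<close>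

definition differences :: "int set \<Rightarrow> int set" where
  "differences C = {d \<in> {1..<n}. \<exists>x\<in>C. x + d \<in> C}"

lemma differences_range: "d \<in> differences C \<Longrightarrow> 1 \<le> d \<and> d < n"
  by (simp add: differences_def)

lemma mem_translate: "x \<in> translate t C \<longleftrightarrow> x - t \<in> C"
  by (simp add: translate_def)

lemma finite_residues: "finite (residues_of C)"
  by (simp add: residues_of_def)

lemma translate_in: "C \<in> \<C> \<Longrightarrow> translate t C \<in> \<C>"
  using shift by (simp add: translate_def)

lemma mod_mem_iff: "C \<in> \<C> \<Longrightarrow> x mod n \<in> C \<longleftrightarrow> x \<in> C"
  by (meson periodic dvd_minus_mod mod_eq_dvd_iff mod_mod_trivial)

lemma residue_mem: "C \<in> \<C> \<Longrightarrow> x \<in> C \<Longrightarrow> x mod n \<in> residues_of C"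
  using n_pos by (simp add: residues_of_def mod_mem_iff)

lemma line_unique:
  assumes "C \<in> \<C>" "C' \<in> \<C>" "x \<in> C" "y \<in> C" "x \<in> C'" "y \<in> C'" "\<not> n dvd y - x"
  shows "C = C'"
  using line[OF assms(7)] assms(1-6) by blast

lemma card_residues_translate:
  assumes "C \<in> \<C>"
  shows "card (residues_of (translate t C)) = card (residues_of C)"
proof -
  have "bij_betw (\<lambda>x. (x + t) mod n) (residues_of C) (residues_of (translate t C))"
  proof (rule bij_betw_byWitness[where f' = "\<lambda>x. (x - t) mod n"])
    show "\<forall>x\<in>residues_of C. ((x + t) mod n - t) mod n = x"
      by (auto simp: residues_of_def mod_diff_left_eq)
    show "\<forall>x\<in>residues_of (translate t C). ((x - t) mod n + t) mod n = x"
      by (auto simp: residues_of_def mod_add_left_eq)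
    show "(\<lambda>x. (x + t) mod n) ` residues_of C \<subseteq> residues_of (translate t C)"
    proof
      fix z assume "z \<in> (\<lambda>x. (x + t) mod n) ` residues_of C"
      then obtain x where x: "x \<in> C" "z = (x + t) mod n" by (auto simp: residues_of_def)
      then have "x + t \<in> translate t C" by (simp add: mem_translate)
      then show "z \<in> residues_of (translate t C)"
        using residue_mem translate_in[OF assms] x(2) by blast
    qed
    show "(\<lambda>x. (x - t) mod n) ` residues_of (translate t C) \<subseteq> residues_of C"
    proof
      fix z assume "z \<in> (\<lambda>x. (x - t) mod n) ` residues_of (translate t C)"
      then obtain x where "x - t \<in> C" "z = (x - t) mod n" by (auto simp: residues_of_def mem_translate)
      then show "z \<in> residues_of C" using residue_mem assms by blast
    qed
  qed
  then show ?thesis using bij_betw_same_card by fastforce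
qed

lemma differences_translate: "differences (translate t C) = differences C"
proof -
  have "(\<exists>x\<in>translate t C. x + d \<in> translate t C) \<longleftrightarrow> (\<exists>x\<in>C. x + d \<in> C)" for d
  proof
    assume "\<exists>x\<in>translate t C. x + d \<in> translate t C"
    then obtain x where "x - t \<in> C" "(x - t) + d \<in> C" by (auto simp: mem_translate algebra_simps)
    then show "\<exists>x\<in>C. x + d \<in> C" by blast
  next
    assume "\<exists>x\<in>C. x + d \<in> C"
    then obtain x where "x \<in> C" "x + d \<in> C" by blast
    then show "\<exists>x\<in>translate t C. x + d \<in> translate t C"
      by (intro bexI[of _ "x + t"]) (auto simp: mem_translate algebra_simps)
  qed
  then show ?thesis by (simp add: differences_def)
qed

lemma not_dvd_residue: "d \<in> {1..<n} \<Longrightarrow> \<not> n dvd d"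
  using zdvd_imp_le[of n d] by auto

text \<open>Move the pair of \<open>C\<close> that realizes \<open>d\<close> onto the one of
  \<open>C'\<close>: the translate and \<open>C'\<close> then share two incongruent points.\<close>

lemma differences_overlap:
  assumes "C \<in> \<C>" "C' \<in> \<C>" "d \<in> differences C" "d \<in> differences C'"
  shows "\<exists>t. C' = translate t C"
proof -
  obtain x y where "x \<in> C" "x + d \<in> C" "y \<in> C'" "y + d \<in> C'" and d: "d \<in> {1..<n}"
    using assms(3,4) by (auto simp: differences_def)
  then have "C' = translate (y - x) C"
    using not_dvd_residue[OF d]
    by (intro line_unique[of _ _ y "y + d"] assms translate_in) (auto simp: mem_translate algebra_simps)
  then show ?thesis by blast
qed

text \<open>Together with \<open>ex_line_through\<close> this makes the distinct difference sets a
  partition of \<open>{1..<n}\<close>, which is what \<open>order_cong\<close> counts.\<close>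

lemma differences_disjoint:
  assumes "C \<in> \<C>" "C' \<in> \<C>" "d \<in> differences C" "d \<in> differences C'"
  shows "differences C' = differences C"
  using differences_overlap[OF assms] differences_translate by auto

lemma ex_line_through:
  assumes "d \<in> {1..<n}"
  obtains C where "C \<in> \<C>" "0 \<in> C" "d \<in> C" "d \<in> differences C"
proof -
  have "\<not> n dvd d - 0" using not_dvd_residue[OF assms] by simp
  then obtain C where C: "C \<in> \<C>" "0 \<in> C" "d \<in> C" using line by blast
  then have "d \<in> differences C" using assms by (auto simp: differences_def intro!: bexI[of _ 0])
  with C that show ?thesis by blast
qed

text \<open>Serves the two kinds of short orbits, whose lines through 0 are subgroups with three or
  four residues.\<close>

lemma subgroup_differences:
  assumes "C \<in> \<C>" "0 \<in> C" "\<And>x y. x \<in> C \<Longrightarrow> y \<in> C \<Longrightarrow> x - y \<in> C"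
  shows "differences C = residues_of C - {0}"
proof
  show "differences C \<subseteq> residues_of C - {0}"
  proof
    fix d assume "d \<in> differences C"
    then obtain x where x: "d \<in> {1..<n}" "x \<in> C" "x + d \<in> C" by (auto simp: differences_def)
    have "(x + d) - x \<in> C" using x by (intro assms(3))
    then show "d \<in> residues_of C - {0}" using x by (auto simp: residues_of_def)
  qed
  show "residues_of C - {0} \<subseteq> differences C"
    using assms(2) by (auto simp: differences_def residues_of_def intro!: bexI[of _ 0])
qed

section \<open>The orbit of triples\<close>

text \<open>Translation by \<open>- y\<close> produces a triple through 0 again, and there is only
  one.\<close>

lemma triple_closed:
  assumes "C \<in> \<C>" "card (residues_of C) = 3" "0 \<in> C" "x \<in> C" "y \<in> C"
  shows "x - y \<in> C"
proof -
  have "translate (- y) C \<in> \<C>" "0 \<in> translate (- y) C" "card (residues_of (translate (- y) C)) = 3"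
    using assms by (simp_all add: translate_in mem_translate card_residues_translate)
  then have "translate (- y) C = C"
    using triple[of 0] assms unfolding residues_of_def by blast
  then show ?thesis using assms(4) by (metis diff_minus_eq_add diff_add_cancel mem_translate)
qed

text \<open>The triple through 0 is a subgroup with three residues, so its nonzero residues have
  order 3. Every triple is a translate of it.\<close>

lemma triple_differences:
  assumes "C \<in> \<C>" "card (residues_of C) = 3"
  shows "card (differences C) = 2"
    and "\<And>d. d \<in> differences C \<Longrightarrow> n dvd 3 * d"
    and "\<And>C'. C' \<in> \<C> \<Longrightarrow> card (residues_of C') = 3 \<Longrightarrow> differences C' = differences C"
proof -
  have norm: "\<exists>C0. C0 \<in> \<C> \<and> card (residues_of C0) = 3 \<and> 0 \<in> C0 \<and> differences C0 = differences C'"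
    if h: "C' \<in> \<C>" "card (residues_of C') = 3" for C'
  proof -
    have "residues_of C' \<noteq> {}" using h(2) by auto
    then obtain c where "c \<in> C'" by (auto simp: residues_of_def)
    then show ?thesis using h
      by (intro exI[of _ "translate (- c) C'"])
         (simp add: translate_in card_residues_translate mem_translate differences_translate)
  qed
  obtain C0 where C0: "C0 \<in> \<C>" "card (residues_of C0) = 3" "0 \<in> C0" "differences C0 = differences C"
    using norm assms by blast
  have closed: "x - y \<in> C0" if "x \<in> C0" "y \<in> C0" for x y using triple_closed C0 that by blast
  have diff: "differences C = residues_of C0 - {0}"
    using subgroup_differences[OF C0(1,3) closed] C0(4) by simp
  have z: "0 \<in> residues_of C0" using C0(3) n_pos by (simp add: residues_of_def)
  then show c2: "card (differences C) = 2" using C0(2) finite_residues diff by simp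
  show "n dvd 3 * d" if d: "d \<in> differences C" for d
  proof -
    have "card (differences C - {d}) = 1" using c2 d by simp
    then obtain e where e: "differences C - {d} = {e}" by (auto simp: card_1_singleton_iff)
    then have R: "residues_of C0 = {0, d, e}" and ed: "e \<noteq> d" "e \<in> {1..<n}" "d \<in> {1..<n}"
      using diff d z by (auto simp: differences_def)
    have C0_iff: "x \<in> C0 \<longleftrightarrow> n dvd x \<or> n dvd x - d \<or> n dvd x - e" for x
    proof -
      have "x \<in> C0 \<longleftrightarrow> x mod n \<in> residues_of C0"
        using n_pos mod_mem_iff[OF C0(1)] by (simp add: residues_of_def)
      also have "\<dots> \<longleftrightarrow> x mod n = 0 \<or> x mod n = d mod n \<or> x mod n = e mod n"
        using R ed by auto
      also have "\<dots> \<longleftrightarrow> n dvd x \<or> n dvd x - d \<or> n dvd x - e"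
        by (simp add: mod_eq_dvd_iff dvd_eq_mod_eq_0)
      finally show ?thesis .
    qed
    have nd: "\<not> n dvd d" "\<not> n dvd e" using ed not_dvd_residue by blast+
    have ne: "\<not> n dvd e - d"
      using ed zdvd_imp_le[of n "\<bar>e - d\<bar>"] by auto
    have dC: "d \<in> C0" "e \<in> C0" by (simp_all add: C0_iff)
    \<comment> \<open>Among the residues 0, \<open>d\<close>, \<open>e\<close>, the difference
      \<open>e - d\<close> can only be \<open>d\<close>: the value 0 would identify \<open>e\<close>
      with \<open>d\<close>, the value \<open>e\<close> would make \<open>d\<close> vanish.\<close>
    have ediff: "n dvd e - 2 * d"
    proof -
      have "e - d \<in> C0" using closed dC by blast
      then have "n dvd e - d - d \<or> n dvd e - d - e" using ne by (auto simp: C0_iff)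
      then show ?thesis using nd by (simp add: algebra_simps)
    qed
    \<comment> \<open>Likewise \<open>- d\<close> is \<open>d\<close> or \<open>e\<close>. The
      former makes \<open>2 * d\<close>, hence \<open>e\<close>, vanish; so \<open>d + e\<close>
      vanishes, and subtracting \<open>e - 2 * d\<close> leaves \<open>3 * d\<close>.\<close>
    have "0 - d \<in> C0" using closed dC C0(3) by blast
    then have "n dvd - d - d \<or> n dvd - d - e" using nd by (auto simp: C0_iff)
    then have "n dvd 2 * d \<or> n dvd d + e"
      by (metis dvd_minus_iff minus_add_distrib mult_2 uminus_add_conv_diff add.commute diff_conv_add_uminus)
    moreover have "\<not> n dvd 2 * d"
      using ediff nd dvd_add[of n "e - 2 * d" "2 * d"] by auto
    ultimately have "n dvd (d + e) - (e - 2 * d)" using ediff dvd_diff by blast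
    then show ?thesis by simp
  qed
  show "differences C' = differences C" if C': "C' \<in> \<C>" "card (residues_of C') = 3" for C'
  proof -
    obtain C1 where C1: "C1 \<in> \<C>" "card (residues_of C1) = 3" "0 \<in> C1" "differences C1 = differences C'"
      using norm C' by blast
    then have "C1 = C0" using triple[of 0] C0 unfolding residues_of_def by blast
    then show ?thesis using C1 C0 by simp
  qed
qed

section \<open>Quadruples and their stabilizers\<close>

text \<open>Normalized to contain 0 and \<open>r\<close>, the line is stable under adding
  \<open>r\<close>. Hence for each of its points \<open>w\<close> the translate by
  \<open>- w\<close> contains 0 and \<open>r\<close> too and equals the line, which is therefore a
  subgroup with four residues.\<close>

lemma involution_differences:
  assumes C: "C \<in> \<C>" "card (residues_of C) = 4" and n: "n = 2 * r" and r: "r \<in> differences C"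
  shows "card (differences C) = 3" and "4 dvd n"
proof -
  have r0: "r > 0" using n n_pos by simp
  have nr: "\<not> n dvd r" using zdvd_imp_le[of n r] n r0 by auto
  obtain x where x: "x \<in> C" "x + r \<in> C" using r by (auto simp: differences_def)
  define D where "D = translate (- x) C"
  have D: "D \<in> \<C>" "card (residues_of D) = 4" "differences D = differences C"
    using C by (simp_all add: D_def translate_in card_residues_translate differences_translate)
  have D0: "0 \<in> D" "r \<in> D" using x by (simp_all add: D_def mem_translate add.commute)
  have tr: "translate t D = D" if "- t \<in> D" "r - t \<in> D" for t
    using nr D0 that by (intro line_unique[of _ _ 0 r] translate_in D(1)) (auto simp: mem_translate)
  have plus_r: "z + r \<in> D" if "z \<in> D" for z
  proof -
    have "- r \<in> D" using D0(2) by (rule periodic[OF D(1)]) (simp add: n)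
    then have "translate r D = D" using D0 by (intro tr) auto
    then show ?thesis using that by (metis add_diff_cancel_right' mem_translate)
  qed
  have sub: "z - w \<in> D" if "z \<in> D" "w \<in> D" for z w
  proof -
    have "translate (- w) D = D" using plus_r[OF that(2)] that(2) by (intro tr) (auto simp: add.commute)
    then show ?thesis using that(1) by (metis add.commute add_diff_cancel_left' diff_minus_eq_add mem_translate diff_add_cancel)
  qed
  have "0 \<in> residues_of D" using D0 n_pos by (simp add: residues_of_def)
  then show "card (differences C) = 3"
    using subgroup_differences[OF D(1) D0(1) sub] D finite_residues by simp
  have rn: "r < n" using n r0 by simp
  have R0: "{0, r} \<subseteq> residues_of D" using D0 r0 rn by (auto simp: residues_of_def)
  have "residues_of D \<noteq> {0, r}"
  proof
    assume "residues_of D = {0, r}"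
    moreover have "card {0, r} \<le> 2" by (simp add: card_insert_le_m1)
    ultimately show False using D(2) by simp
  qed
  then obtain y where y: "y \<in> D" "0 < y" "y < n" "y \<noteq> r"
    using R0 unfolding residues_of_def by force
  let ?Y = "{0, r, y, (y + r) mod n}"
  have ny: "\<not> n dvd y" using zdvd_imp_le[of n y] y by auto
  have nyr: "\<not> n dvd y - r" using zdvd_imp_le[of n "\<bar>y - r\<bar>"] y n by auto
  have nyr': "\<not> n dvd y + r"
  proof
    assume "n dvd y + r"
    then have "n dvd y + r - n" by simp
    then show False using nyr n by simp
  qed
  have Yeq: "n dvd (y + r) - c" if "(y + r) mod n = c" for c
    using that by (metis dvd_minus_mod)
  have "card ?Y = 4"
  proof -
    have "(y + r) mod n \<noteq> 0" using nyr' by auto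
    moreover have "(y + r) mod n \<noteq> r" using Yeq[of r] ny by auto
    moreover have "(y + r) mod n \<noteq> y" using Yeq[of y] nr by auto
    ultimately show ?thesis using y r0 by simp
  qed
  moreover have "?Y \<subseteq> residues_of D"
    using R0 y plus_r[OF y(1)] residue_mem[OF D(1)] by (auto simp: residues_of_def)
  ultimately have RY: "residues_of D = ?Y" using D(2) finite_residues by (metis card_subset_eq)
  \<comment> \<open>The residue of \<open>- y\<close> is among the four. It is not \<open>y\<close>,
    which would force \<open>y = r\<close>, so it is that of \<open>y + r\<close>. Then
    \<open>n = 2 * r\<close> divides \<open>2 * y + r\<close>, and \<open>r\<close> is even.\<close>
  have "(- y) mod n \<in> residues_of D" using residue_mem[OF D(1)] sub[OF D0(1) y(1)] by simp
  then have "n - y \<in> ?Y" using RY y by (simp add: zmod_zminus1_eq_if)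
  then have "n - y = y \<or> n - y = (y + r) mod n" using y n by auto
  then have "n dvd 2 * y + r"
  proof
    assume "n - y = y"
    then show ?thesis using y n by simp
  next
    assume "n - y = (y + r) mod n"
    then have "n dvd (y + r) - (n - y)" using Yeq by metis
    then have "n dvd (y + r) - (n - y) + n" by (intro dvd_add) auto
    then show ?thesis by (simp add: algebra_simps)
  qed
  then obtain k where "2 * y + r = n * k" by blast
  then have "r = 2 * (r * k - y)" using n by (simp add: algebra_simps)
  then have "n = 4 * (r * k - y)" using n by simp
  then show "4 dvd n" by simp
qed

text \<open>Five points \<open>x + i * t\<close> cannot have distinct residues on the line, so
  \<open>t\<close> has order 2, 3 or 4 modulo \<open>n\<close>. Even order yields \<open>r\<close>;
  under order 3 the one residue outside the orbit of \<open>x\<close> would have no image.\<close>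

lemma quadruple_stabilizer:
  assumes C: "C \<in> \<C>" "card (residues_of C) = 4" and t: "\<not> n dvd t" "translate t C = C"
  shows "\<exists>r. n = 2 * r \<and> r \<in> differences C"
proof -
  have step: "z + t \<in> C" if "z \<in> C" for z
    using t(2) that by (metis add_diff_cancel_right' mem_translate)
  have "residues_of C \<noteq> {}" using C(2) by auto
  then obtain x where x: "x \<in> C" by (auto simp: residues_of_def)
  have mult: "x + int i * t \<in> C" for i
  proof (induction i)
    case (Suc i)
    then show ?case using step[OF Suc] by (simp add: algebra_simps)
  qed (simp add: x)
  \<comment> \<open>Any \<open>h\<close> of order two modulo \<open>n\<close> that joins two points
    of the line will do: its residue is half of \<open>n\<close>.\<close>
  have half: ?thesis if h: "n dvd 2 * h" "\<not> n dvd h" "x + h \<in> C" for h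
  proof -
    let ?r = "h mod n"
    have "?r \<noteq> 0" using h(2) by (simp add: dvd_eq_mod_eq_0)
    then have r: "0 < ?r" "?r < n"
      using pos_mod_sign[OF n_pos, of h] pos_mod_bound[OF n_pos, of h] by linarith+
    have "n dvd 2 * ?r" using h(1) by (simp add: dvd_eq_mod_eq_0 mod_mult_right_eq)
    then obtain k where k: "2 * ?r = n * k" by blast
    then have "0 < n * k" "n * k < n * 2" using r by linarith+
    then have "0 < k" "k < 2"
      using n_pos zero_less_mult_pos mult_less_cancel_left_pos[OF n_pos, of k 2] by blast+
    then have "k = 1" by simp
    then have "n = 2 * ?r" using k by simp
    moreover have "x + ?r \<in> C"
      by (rule periodic[OF C(1) h(3)]) (simp add: mod_eq_dvd_iff[symmetric])
    ultimately show ?thesis using x r by (intro exI[of _ ?r]) (auto simp: differences_def)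
  qed
  have "\<not> inj_on (\<lambda>i. (x + int i * t) mod n) {0..4}"
  proof
    assume "inj_on (\<lambda>i. (x + int i * t) mod n) {0..4}"
    then have "card {0..4::nat} \<le> card (residues_of C)"
      using residue_mem[OF C(1) mult] finite_residues by (intro card_inj_on_le) auto
    then show False using C(2) by simp
  qed
  then obtain i j :: nat where ij: "i < j" "j \<le> 4" "(x + int j * t) mod n = (x + int i * t) mod n"
    unfolding inj_on_def by (metis atLeastAtMost_iff linorder_neqE_nat)
  define s where "s = j - i"
  have "n dvd (x + int j * t) - (x + int i * t)" using ij(3) by (simp add: mod_eq_dvd_iff)
  then have dv: "n dvd int s * t" using ij(1) by (simp add: s_def algebra_simps of_nat_diff)
  have "s = 1 \<or> s = 2 \<or> s = 3 \<or> s = 4" using ij by (auto simp: s_def)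
  then consider "n dvd t" | "n dvd 2 * t" | "n dvd 3 * t" | "n dvd 4 * t" "\<not> n dvd 2 * t"
    using dv by (cases "n dvd 2 * t") auto
  then show ?thesis
  proof cases
    case 1
    then show ?thesis using t(1) by simp
  next
    case 2
    then show ?thesis using half[of t] t(1) step[OF x] by simp
  next
    case 4
    have "n dvd 2 * (2 * t)" using 4(1) by simp
    then show ?thesis using half[of "2 * t"] 4(2) mult[of 2] by simp
  next
    case 3
    \<comment> \<open>The orbit of \<open>x\<close> omits a single residue \<open>y\<close>. As
      \<open>y + t\<close> is not \<open>y\<close>, it lies in the orbit, and then so does
      \<open>y\<close>.\<close>
    let ?Q = "{x mod n, (x + t) mod n, (x + 2 * t) mod n}"
    have "card ?Q \<le> 3" by (rule order_trans[OF card_insert_le_m1]) (auto simp: card_insert_le_m1)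
    then have "\<not> residues_of C \<subseteq> ?Q" using C(2) card_mono[of ?Q "residues_of C"] by auto
    then obtain y where y: "y \<in> residues_of C" "y \<notin> ?Q" by blast
    define q where "q i = x + int i * t" for i :: nat
    have yQ: "\<not> n dvd y - q i" for i
    proof
      assume "n dvd y - q i"
      moreover have "n dvd q i - q (i mod 3)"
      proof -
        have "q (j + 3 * l) - q j = int l * (3 * t)" for j l by (simp add: q_def algebra_simps)
        from this[of "i mod 3" "i div 3"] have "q i - q (i mod 3) = int (i div 3) * (3 * t)" by simp
        then show ?thesis using 3 by simp
      qed
      ultimately have "n dvd (y - q i) + (q i - q (i mod 3))" by (rule dvd_add)
      then have "y mod n = q (i mod 3) mod n" by (simp add: mod_eq_dvd_iff)
      moreover have "y mod n = y" using y by (simp add: residues_of_def)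
      moreover have "i mod 3 = 0 \<or> i mod 3 = 1 \<or> i mod 3 = 2" by linarith
      ultimately show False using y(2) by (auto simp: q_def)
    qed
    let ?Z = "{y, x mod n, (x + t) mod n, (x + 2 * t) mod n}"
    have "card ?Z = 4"
    proof -
      have "\<not> n dvd 2 * t"
      proof
        assume "n dvd 2 * t"
        then have "n dvd 3 * t - 2 * t" using 3 dvd_diff by blast
        then show False using t(1) by simp
      qed
      then have "x mod n \<noteq> (x + t) mod n" "x mod n \<noteq> (x + 2 * t) mod n" "(x + t) mod n \<noteq> (x + 2 * t) mod n"
        using t(1) by (simp_all add: mod_eq_dvd_iff)
      then show ?thesis using y(2) by simp
    qed
    moreover have "?Z \<subseteq> residues_of C"
      using y(1) residue_mem[OF C(1)] mult[of 0] mult[of 1] mult[of 2] by auto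
    ultimately have RZ: "residues_of C = ?Z" using C(2) finite_residues by (metis card_subset_eq)
    have "y \<in> C" using y(1) by (simp add: residues_of_def)
    then have "(y + t) mod n \<in> residues_of C" using step residue_mem[OF C(1)] by blast
    moreover have "(y + t) mod n \<noteq> y"
    proof
      assume "(y + t) mod n = y"
      then have "n dvd (y + t) - y" by (metis dvd_minus_mod)
      then show False using t(1) by simp
    qed
    ultimately have "(y + t) mod n = q 0 mod n \<or> (y + t) mod n = q 1 mod n \<or> (y + t) mod n = q 2 mod n"
      using RZ by (auto simp: q_def)
    then obtain i where "(y + t) mod n = q i mod n" by blast
    then have "n dvd (y + t) - q i" by (simp add: mod_eq_dvd_iff)
    \<comment> \<open>Stepping back once is stepping forward twice, which keeps the index of
      \<open>q\<close> a natural number.\<close>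
    then have "n dvd ((y + t) - q i) - 3 * t" using 3 by (rule dvd_diff)
    moreover have "((y + t) - q i) - 3 * t = y - q (i + 2)" by (simp add: q_def algebra_simps)
    ultimately show ?thesis using yQ by simp
  qed
qed

text \<open>Passes from periodic sets to pairs of residues, which can be counted.\<close>

lemma differences_image:
  assumes C: "C \<in> \<C>"
  shows "differences C = (\<lambda>(x, y). (y - x) mod n) `
    {(x, y). x \<in> residues_of C \<and> y \<in> residues_of C \<and> x \<noteq> y}" (is "_ = ?g ` ?O")
proof
  show "differences C \<subseteq> ?g ` ?O"
  proof
    fix d assume "d \<in> differences C"
    then obtain x where x: "d \<in> {1..<n}" "x \<in> C" "x + d \<in> C" by (auto simp: differences_def)
    have "((x + d) mod n - x mod n) mod n = d" using x(1) by (simp add: mod_diff_eq)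
    moreover from this have "x mod n \<noteq> (x + d) mod n" using x(1) by auto
    ultimately show "d \<in> ?g ` ?O" using residue_mem[OF C] x
      by (intro image_eqI[of _ _ "(x mod n, (x + d) mod n)"]) auto
  qed
  show "?g ` ?O \<subseteq> differences C"
  proof
    fix d assume "d \<in> ?g ` ?O"
    then obtain x y where xy: "x \<in> residues_of C" "y \<in> residues_of C" "x \<noteq> y" "d = (y - x) mod n" by auto
    have "d \<noteq> 0"
    proof
      assume "d = 0"
      then have "x mod n = y mod n" using xy(4) by (metis mod_eq_dvd_iff mod_0_imp_dvd)
      then show False using xy(1-3) by (simp add: residues_of_def)
    qed
    then have "1 \<le> d" "d < n" using xy(4) pos_mod_sign[OF n_pos, of "y - x"]
      pos_mod_bound[OF n_pos, of "y - x"] by linarith+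
    then have "d \<in> {1..<n}" by simp
    moreover have "x + d \<in> C"
    proof (rule periodic[OF C, of y])
      show "y \<in> C" using xy by (simp add: residues_of_def)
      have "n dvd (y - x) - d" using xy(4) by (simp add: dvd_minus_mod)
      then show "n dvd x + d - y" by (simp add: dvd_diff_commute algebra_simps)
    qed
    ultimately show "d \<in> differences C" using xy(1) by (auto simp: differences_def residues_of_def)
  qed
qed

text \<open>Two ordered pairs with the same difference are related by a translation, which fixes the
  line by uniqueness. So a trivial stabilizer leaves twelve distinct differences.\<close>

lemma quadruple_differences:
  assumes C: "C \<in> \<C>" "card (residues_of C) = 4"
  shows "card (differences C) = 12 \<or>
    card (differences C) = 3 \<and> 4 dvd n \<and> (\<exists>r. n = 2 * r \<and> r \<in> differences C)"
proof (cases "\<exists>t. \<not> n dvd t \<and> translate t C = C")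
  case True
  then obtain r where "n = 2 * r" "r \<in> differences C" using quadruple_stabilizer C by blast
  then show ?thesis using involution_differences[OF C] by blast
next
  case False
  let ?O = "{(x, y). x \<in> residues_of C \<and> y \<in> residues_of C \<and> x \<noteq> y}"
  have "inj_on (\<lambda>(x, y). (y - x) mod n) ?O"
  proof (rule inj_onI, clarify)
    fix x y x' y'
    assume xy: "x \<in> residues_of C" "y \<in> residues_of C" "x' \<in> residues_of C" "y' \<in> residues_of C"
      "x \<noteq> y" "x' \<noteq> y'" and eq: "(y - x) mod n = (y' - x') mod n"
    have nd: "n dvd (y - x) - (y' - x')" using eq by (simp add: mod_eq_dvd_iff)
    have uniq: "a = b" if "n dvd a - b" "a \<in> residues_of C" "b \<in> residues_of C" for a b
    proof -
      have "a mod n = b mod n" using that(1) by (simp add: mod_eq_dvd_iff)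
      then show ?thesis using that(2,3) by (simp add: residues_of_def)
    qed
    have "\<not> n dvd y' - x'" using uniq[of y' x'] xy by auto
    moreover have "y' - (x' - x) \<in> C"
      by (rule periodic[OF C(1), of y])
         (use xy nd in \<open>auto simp: residues_of_def algebra_simps dvd_diff_commute\<close>)
    ultimately have "translate (x' - x) C = C"
      using xy C by (intro line_unique[of _ _ x' y'] translate_in) (auto simp: mem_translate residues_of_def)
    then have "n dvd x' - x" using False by blast
    then have x: "x' = x" using uniq xy by blast
    then have "y = y'" using nd uniq xy by simp
    then show "x = x' \<and> y = y'" using x by simp
  qed
  then have "card (differences C) = card ?O"
    unfolding differences_image[OF C(1)] by (rule card_image)
  then show ?thesis using card_off_diagonal[OF finite_residues, of C] C(2) by simp
qed

section \<open>The order modulo 12\<close>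

lemma order_cong: "n mod 12 = 3"
proof -
  let ?P = "differences ` \<C>"
  have fin: "finite ?P"
    by (rule finite_subset[of _ "Pow {1..<n}"]) (auto simp: differences_def)
  have finQ: "finite Q" if "Q \<in> ?P" for Q
    by (rule finite_subset[of _ "{1..<n}"]) (use that in \<open>auto simp: differences_def\<close>)
  have "\<Union>?P = {1..<n}"
  proof
    show "\<Union>?P \<subseteq> {1..<n}" by (auto simp: differences_def)
    show "{1..<n} \<subseteq> \<Union>?P" using ex_line_through by blast
  qed
  moreover have "pairwise disjnt ?P"
    unfolding pairwise_def disjnt_def using differences_disjoint by blast
  ultimately have sum: "(\<Sum>Q\<in>?P. card Q) = nat (n - 1)"
    using card_Union_disjoint[of ?P] finQ by simp
  obtain C3 where C3: "C3 \<in> \<C>" "card (residues_of C3) = 3"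
    using triple[of 0] by (auto simp: residues_of_def)
  let ?D = "differences C3"
  have D: "?D \<in> ?P" "card ?D = 2" using C3 triple_differences(1) by auto
  have rest: "card Q = 12 \<or> card Q = 3 \<and> 4 dvd n \<and> (\<exists>r. n = 2 * r \<and> r \<in> Q)" if "Q \<in> ?P - {?D}" for Q
  proof -
    obtain C where C: "C \<in> \<C>" "Q = differences C" "Q \<noteq> ?D" using \<open>Q \<in> ?P - {?D}\<close> by auto
    then have "card (residues_of C) = 4" using size[OF C(1)] triple_differences(3)[OF C3 C(1)]
      by (auto simp: residues_of_def)
    then show ?thesis using quadruple_differences[OF C(1)] C(2) by simp
  qed
  have sumD: "nat (n - 1) = 2 + (\<Sum>Q\<in>?P - {?D}. card Q)"
    using sum sum.remove[OF fin D(1), of card] D(2) by simp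
  show ?thesis
  proof (cases "\<exists>Q\<in>?P - {?D}. card Q \<noteq> 12")
    case False
    then have "nat (n - 1) = 2 + 12 * card (?P - {?D})" using sumD by simp
    then have "n = 12 * int (card (?P - {?D})) + 3" using n_pos by linarith
    then show ?thesis by presburger
  next
    case True
    then obtain Q where Q: "Q \<in> ?P - {?D}" "card Q \<noteq> 12" by blast
    then obtain r where r: "card Q = 3" "4 dvd n" "n = 2 * r" "r \<in> Q" using rest by blast
    \<comment> \<open>Every exceptional set contains half of \<open>n\<close>, so disjointness
      allows only one.\<close>
    have others: "card Q' = 12" if "Q' \<in> ?P - {?D} - {Q}" for Q'
    proof (rule ccontr)
      assume "card Q' \<noteq> 12"
      then have "r \<in> Q'" using rest[of Q'] that r(3) by auto
      then show False using differences_disjoint Q(1) r(4) that by blast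
    qed
    have "(\<Sum>Q\<in>?P - {?D}. card Q) = 3 + (\<Sum>Q\<in>?P - {?D} - {Q}. card Q)"
      using sum.remove[of "?P - {?D}" Q card] fin Q(1) r(1) by simp
    also have "\<dots> = 3 + 12 * card (?P - {?D} - {Q})" using others by simp
    finally have "n = 12 * int (card (?P - {?D} - {Q})) + 6" using sumD n_pos by linarith
    then show ?thesis using r(2) by presburger
  qed
qed

section \<open>Exclusion of n = 27\<close>

text \<open>The triples use exactly the differences 9 and 18, so the line is a quadruple; as 4 does
  not divide 27, it has twelve differences. Moving it onto 0 and \<open>e\<close> gives the form
  searched, and the listed memberships are the pruning conditions.\<close>

lemma order_27_differences:
  assumes n: "n = 27" and C: "C \<in> \<C>" and e: "e \<in> differences C" "e \<noteq> 9" "e \<noteq> 18"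
  obtains x y where "x < y" "set (block_differences 0 e x y) = differences C" "distinct (block_differences 0 e x y)"
    "{x, y, (x - e) mod 27, (y - e) mod 27} \<subseteq> differences C" "9 \<notin> differences C" "18 \<notin> differences C"
proof -
  obtain C3 where C3: "C3 \<in> \<C>" "card (residues_of C3) = 3"
    using triple[of 0] by (auto simp: residues_of_def)
  have "differences C3 \<subseteq> {9, 18}"
  proof
    fix d assume d: "d \<in> differences C3"
    then have "27 dvd 3 * d" "1 \<le> d" "d < 27"
      using triple_differences(2)[OF C3 d] differences_range[OF d] n by simp_all
    then have "d = 9 \<or> d = 18" by presburger
    then show "d \<in> {9, 18}" by simp
  qed
  then have D3: "differences C3 = {9, 18}"
    using triple_differences(1)[OF C3] by (intro card_subset_eq) auto
  have not3: "9 \<notin> differences C" "18 \<notin> differences C"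
    using differences_disjoint[OF C3(1) C] D3 e by blast+
  have "e \<in> {1..<27}" using differences_range[OF e(1)] n by simp
  have c4: "card (residues_of C) = 4"
  proof (rule ccontr)
    assume "card (residues_of C) \<noteq> 4"
    then have "card (residues_of C) = 3" using size[OF C] by (auto simp: residues_of_def)
    then show False using triple_differences(3)[OF C3 C] D3 e by simp
  qed
  have c12: "card (differences C) = 12"
  proof -
    have "\<not> 4 dvd n" using n by simp
    then show ?thesis using quadruple_differences[OF C c4] by blast
  qed
  obtain a where a: "a \<in> C" "a + e \<in> C" using e by (auto simp: differences_def)
  define B where "B = translate (- a) C"
  have B: "B \<in> \<C>" "card (residues_of B) = 4" "differences B = differences C" "0 \<in> B" "e \<in> B"
    using C c4 a by (simp_all add: B_def translate_in card_residues_translate differences_translate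
        mem_translate add.commute)
  have in_res: "{0, e} \<subseteq> residues_of B" using B(4,5) differences_range[OF e(1)] by (simp add: residues_of_def)
  have "card (residues_of B - {0, e}) = 2"
    using in_res B(2) \<open>e \<in> {1..<27}\<close> by (subst card_Diff_subset) auto
  then obtain x y where xy: "residues_of B - {0, e} = {x, y}" "x < y"
    by (metis card_2_iff insert_commute linorder_neq_iff)
  then have R: "residues_of B = {0, e, x, y}" using in_res by blast
  have dist: "e \<noteq> 0" "x \<noteq> 0" "y \<noteq> 0" "x \<noteq> e" "y \<noteq> e" "x \<noteq> y" using xy \<open>e \<in> {1..<27}\<close> by auto
  have "{(u, v). u \<in> residues_of B \<and> v \<in> residues_of B \<and> u \<noteq> v} =
    {(0, e), (e, 0), (0, x), (x, 0), (0, y), (y, 0), (e, x), (x, e), (e, y), (y, e), (x, y), (y, x)}"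
    unfolding R using dist by auto
  then have "differences B = set (block_differences 0 e x y)"
    unfolding differences_image[OF B(1)] by (simp add: block_differences_def n)
  then have S: "set (block_differences 0 e x y) = differences C" using B(3) by simp
  moreover have "distinct (block_differences 0 e x y)"
    by (rule card_distinct) (use S c12 in \<open>simp add: block_differences_def\<close>)
  moreover have "{x, y, (x - e) mod 27, (y - e) mod 27} \<subseteq> differences C"
  proof -
    have "x \<in> {0..<n}" "y \<in> {0..<n}" using R unfolding residues_of_def by blast+
    then have "x \<in> {1..<27}" "y \<in> {1..<27}" using dist n by simp_all
    then have "x = (x - 0) mod 27" "y = (y - 0) mod 27" by simp_all
    then show ?thesis unfolding S[symmetric] by (simp add: block_differences_def)
  qed
  ultimately show ?thesis using that xy(2) not3 by blast
qed

lemma order_not_27: "n \<noteq> 27"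
proof
  assume n: "n = 27"
  obtain C where C: "C \<in> \<C>" "1 \<in> differences C" using ex_line_through[of 1] n by auto
  obtain x y where less: "x < y" and xy: "set (block_differences 0 1 x y) = differences C" "distinct (block_differences 0 1 x y)"
    "{x, y, (x - 1) mod 27, (y - 1) mod 27} \<subseteq> differences C" "9 \<notin> differences C" "18 \<notin> differences C"
    using order_27_differences[OF n C] by auto
  let ?D = "block_differences 0 1 x y"
  let ?R = "remaining ?D"
  have R: "set ?R = {1..<27} - {9, 18} - differences C"
  proof -
    have "set [1,2,3,4,5,6,7,8,10,11,12,13,14,15,16,17,19,20,21,22,23,24,25,26] = {1..<27} - {9, 18 :: int}"
      by (auto, presburger)
    then show ?thesis unfolding remaining_def set_filter xy(1) by blast
  qed
  have range: "z \<in> {1..<27}" if "z \<in> differences C'" for z C' using differences_range[OF that] n by simp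
  \<comment> \<open>Otherwise \<open>x - 1\<close> or \<open>y - 1\<close> would give the difference
    0; hence the search range starts at 2.\<close>
  have "x \<noteq> 1" "y \<noteq> 1" using range[of 0] xy(3) by auto
  then have "x \<in> set [2..26]" "y \<in> set [2..26]"
    unfolding set_upto using range[of x C] range[of y C] xy(3) by auto
  then have D: "?D \<in> set (filter (\<lambda>D. 9 \<notin> set D) (blocks_from 1 [2..26]))"
    using blocks_from_memI less xy(1,2,4) unfolding set_filter by blast
  \<comment> \<open>Of 24 candidate differences the first block uses at most twelve, so
    \<open>hd ?R\<close> is meaningful.\<close>
  have "?R \<noteq> []"
  proof
    assume "?R = []"
    then have "{1..<27} - {9, 18} \<subseteq> set ?D" using R xy(1) by auto
    then have "card ({1..<27} - {9, 18 :: int}) \<le> card (set ?D)" by (intro card_mono) auto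
    also have "\<dots> \<le> 12" using card_length[of ?D] by (simp add: block_differences_def)
    finally show False by (simp add: card_Diff_subset)
  qed
  define e where "e = hd ?R"
  have e: "e \<in> set ?R" using \<open>?R \<noteq> []\<close> by (simp add: e_def)
  then have e': "e \<in> {1..<27}" "e \<noteq> 9" "e \<noteq> 18" "e \<notin> differences C" using R by auto
  obtain C' where C': "C' \<in> \<C>" "e \<in> differences C'" using ex_line_through[of e] n e'(1) by blast
  obtain z w where less': "z < w" and zw: "set (block_differences 0 e z w) = differences C'" "distinct (block_differences 0 e z w)"
    "{z, w, (z - e) mod 27, (w - e) mod 27} \<subseteq> differences C'" "9 \<notin> differences C'" "18 \<notin> differences C'"
    using order_27_differences[OF n C' e'(2,3)] by auto
  have "differences C' \<inter> differences C = {}"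
    using differences_disjoint[OF C'(1) C(1)] C'(2) e'(4) by blast
  then have sub: "differences C' \<subseteq> set ?R" using R range zw(4,5) by auto
  let ?S = "filter (\<lambda>z. (z - e) mod 27 \<in> set ?R) ?R"
  have "z \<in> set ?S" "w \<in> set ?S" using sub zw(3) by auto
  from blocks_from_memI[OF this less' zw(2)]
  have "block_differences 0 e z w \<in> set (blocks_from e ?S)" .
  moreover have "set (block_differences 0 e z w) \<subseteq> set ?R" using zw(1) sub by simp
  ultimately have "block_differences 0 e z w \<in> set (extensions ?R)"
    by (simp only: extensions_def e_def[symmetric] set_filter mem_Collect_eq)
  moreover have "extensions ?R = []" using no_two_blocks_mod_27 D unfolding list_all_iff by blast
  ultimately show False by simp
qed

end

section \<open>From a 1-rotational system to periodic lines\<close>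

text \<open>\<open>pt\<close> wraps the integers around the cycle of \<open>f\<close>, and each
  block is replaced by its preimage; blocks through \<open>p\<close> lose a point and become the
  triples.\<close>

lemma rotational_lines_of_system:
  assumes sys: "one_rotational_steiner_system_2 4 v X \<B>" and v: "v \<ge> 2"
  shows "\<exists>\<C>. rotational_lines (int v - 1) \<C>"
proof -
  obtain f p where f: "f permutes X" "(\<lambda>B. f ` B) ` \<B> = \<B>" and p: "p \<in> X" "f p = p" "cyclic_on f (X - {p})"
    using sys unfolding one_rotational_steiner_system_2_def design_automorphism_def by blast
  have X: "finite X" "card X = v" and blk: "\<And>B. B \<in> \<B> \<Longrightarrow> B \<subseteq> X \<and> card B = 4"
    and pair: "\<And>x y. x \<in> X \<Longrightarrow> y \<in> X \<Longrightarrow> x \<noteq> y \<Longrightarrow> \<exists>!B. B \<in> \<B> \<and> x \<in> B \<and> y \<in> B"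
    using sys unfolding one_rotational_steiner_system_2_def steiner_system_2_def by blast+
  obtain s where s: "s \<in> X - {p}" "X - {p} = orbit f s" using p(3) unfolding cyclic_on_def by blast
  \<comment> \<open>The first return time of \<open>s\<close>, that is, the length of the
    cycle.\<close>
  define N where "N = funpow_dist1 f s s"
  define n where "n = int v - 1"
  have so: "s \<in> orbit f s" using s by simp
  have orb: "X - {p} = (\<lambda>i. (f ^^ i) s) ` {0..<N}"
    using s(2) orbit_conv_funpow_dist1[OF so] by (simp add: N_def)
  have injN: "inj_on (\<lambda>i. (f ^^ i) s) {0..<N}" unfolding N_def by (rule inj_on_funpow_dist1[OF so])
  have per: "(f ^^ N) s = s" unfolding N_def by (rule funpow_dist1_prop[OF so])
  have "card (X - {p}) = N" using orb injN by (simp add: card_image)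
  then have Nn: "int N = n" using X p(1) v by (simp add: n_def)
  have n0: "n > 0" using v by (simp add: n_def)
  define pt where "pt i = (f ^^ nat (i mod n)) s" for i
  define S where "S B = {i. pt i \<in> B}" for B
  have pt_eq: "pt x = pt y \<longleftrightarrow> n dvd y - x" for x y
  proof -
    have "pt x = pt y \<longleftrightarrow> nat (x mod n) = nat (y mod n)"
      unfolding pt_def using n0 Nn by (intro inj_on_eq_iff[OF injN]) (auto simp: nat_less_iff)
    also have "\<dots> \<longleftrightarrow> n dvd y - x"
      using n0 by (simp add: nat_eq_iff mod_eq_dvd_iff dvd_diff_commute)
    finally show ?thesis .
  qed
  have pt_X: "pt x \<in> X - {p}" for x
    unfolding orb pt_def using n0 Nn by (auto simp: nat_less_iff)
  have f_pt: "(f ^^ k) (pt x) = pt (x + int k)" for k x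
  proof -
    have "(f ^^ k) (pt x) = (f ^^ (k + nat (x mod n))) s" by (simp add: pt_def funpow_add)
    also have "\<dots> = (f ^^ ((k + nat (x mod n)) mod N)) s" using per by (simp add: funpow_mod_eq)
    also have "(k + nat (x mod n)) mod N = nat ((x + int k) mod n)"
    proof -
      have "int ((k + nat (x mod n)) mod N) = (int k + x mod n) mod n"
        using n0 by (simp add: zmod_int Nn)
      also have "\<dots> = (x + int k) mod n" by (simp add: mod_add_right_eq add.commute)
      finally show ?thesis by simp
    qed
    finally show ?thesis by (simp add: pt_def)
  qed
  have card_S: "card (S B \<inter> {0..<n}) = (if p \<in> B then 3 else 4)" if B: "B \<in> \<B>" for B
  proof -
    have "inj_on pt (S B \<inter> {0..<n})"
    proof (rule inj_onI)
      fix x y assume xy: "x \<in> S B \<inter> {0..<n}" "y \<in> S B \<inter> {0..<n}" and eq: "pt x = pt y"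
      have "x mod n = y mod n" using eq by (simp add: pt_eq mod_eq_dvd_iff dvd_diff_commute)
      moreover have "x mod n = x" "y mod n = y" using xy by simp_all
      ultimately show "x = y" by metis
    qed
    moreover have "pt ` (S B \<inter> {0..<n}) = B - {p}"
    proof
      show "pt ` (S B \<inter> {0..<n}) \<subseteq> B - {p}" using pt_X by (auto simp: S_def)
      show "B - {p} \<subseteq> pt ` (S B \<inter> {0..<n})"
      proof
        fix b assume b: "b \<in> B - {p}"
        then have "b \<in> X - {p}" using blk[OF B] by blast
        then obtain i where i: "i < N" "b = (f ^^ i) s" unfolding orb by auto
        then have "b = pt (int i)" using Nn by (simp add: pt_def)
        then show "b \<in> pt ` (S B \<inter> {0..<n})" using i(1) b Nn
          by (intro image_eqI[of _ _ "int i"]) (auto simp: S_def)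
      qed
    qed
    ultimately have "card (S B \<inter> {0..<n}) = card (B - {p})" by (metis card_image)
    then show ?thesis using blk[OF B] X(1) by (auto simp: finite_subset)
  qed
  have pow_B: "(f ^^ k) ` B \<in> \<B>" if "B \<in> \<B>" for B k
  proof (induction k)
    case (Suc k)
    then have "f ` (f ^^ k) ` B \<in> \<B>" using f(2) by blast
    then show ?case by (simp add: image_comp)
  qed (use that in simp)
  have inj_pow: "inj (f ^^ k)" for k using f(1) by (simp add: inj_fn permutes_inj)
  have "rotational_lines n (S ` \<B>)"
  proof
    show "n > 0" by (rule n0)
  next
    fix C x y assume "C \<in> S ` \<B>" "x \<in> C" "n dvd y - x"
    then show "y \<in> C" using pt_eq[of x y] by (auto simp: S_def)
  next
    fix C assume "C \<in> S ` \<B>"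
    then show "card (C \<inter> {0..<n}) \<in> {3, 4}" using card_S by (auto split: if_splits)
  next
    fix x y assume "\<not> n dvd y - x"
    then have "\<exists>!B. B \<in> \<B> \<and> pt x \<in> B \<and> pt y \<in> B" using pt_X pt_eq by (intro pair) auto
    then show "\<exists>!C. C \<in> S ` \<B> \<and> x \<in> C \<and> y \<in> C" unfolding S_def by blast
  next
    fix C t assume "C \<in> S ` \<B>"
    then obtain B where B: "B \<in> \<B>" "C = S B" by blast
    \<comment> \<open>Every integer shift, negative ones included, is a natural power of
      \<open>f\<close>.\<close>
    define k where "k = nat (t mod n)"
    have "pt x \<in> (f ^^ k) ` B \<longleftrightarrow> pt (x - t) \<in> B" for x
    proof -
      have "n dvd t - t mod n" by (rule dvd_minus_mod)
      then have "pt x = (f ^^ k) (pt (x - t))" using n0 by (simp add: f_pt pt_eq k_def algebra_simps dvd_diff_commute)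
      then show ?thesis using inj_image_mem_iff[OF inj_pow] by simp
    qed
    then have "{x. x - t \<in> C} = S ((f ^^ k) ` B)" by (simp add: B(2) S_def)
    then show "{x. x - t \<in> C} \<in> S ` \<B>" using pow_B[OF B(1)] by blast
  next
    fix x
    have "p \<noteq> pt x" using pt_X[of x] by auto
    then have "\<exists>!B. B \<in> \<B> \<and> p \<in> B \<and> pt x \<in> B" using pt_X p(1) by (intro pair) auto
    then obtain B where B: "B \<in> \<B>" "p \<in> B" "pt x \<in> B"
      and uniq: "\<And>B'. B' \<in> \<B> \<Longrightarrow> p \<in> B' \<Longrightarrow> pt x \<in> B' \<Longrightarrow> B' = B" by blast
    show "\<exists>!C. C \<in> S ` \<B> \<and> x \<in> C \<and> card (C \<inter> {0..<n}) = 3"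
    proof (rule ex1I[of _ "S B"])
      show "S B \<in> S ` \<B> \<and> x \<in> S B \<and> card (S B \<inter> {0..<n}) = 3"
        using B card_S by (auto simp: S_def)
      fix C assume C: "C \<in> S ` \<B> \<and> x \<in> C \<and> card (C \<inter> {0..<n}) = 3"
      then obtain B' where B': "B' \<in> \<B>" "C = S B'" "pt x \<in> B'" by (auto simp: S_def)
      then have "p \<in> B'" using C card_S[OF B'(1)] by (auto split: if_splits)
      then show "C = S B" using uniq B' by simp
    qed
  qed
  then show ?thesis unfolding n_def by blast
qed

section \<open>Existence\<close>

lemma one_rotational_existence:
  assumes "k \<noteq> 2"
  shows "\<exists>(X :: nat set) \<B>. one_rotational_steiner_system_2 4 (12 * k + 4) X \<B>"
proof (cases "k < 6")
  case True
  then consider "k = 0" | "k = 1" | "k = 3" | "k = 4" | "k = 5" using assms by linarith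
  then obtain bs where "small_certificate (int k) bs"
    by cases (use small_certificate_values in \<open>simp; blast\<close>)+
  from small_certificate_one_rotational[OF this] show ?thesis
    by (simp add: nat_add_distrib nat_mult_distrib)
next
  case False
  \<comment> \<open>The offset 6 matches the constants of the certificates, which run from 6 to
    11.\<close>
  define m where "m = (k - 6) div 6"
  have "k = 6 * m + 6 + (k - 6) mod 6" using False unfolding m_def by presburger
  moreover have "(k - 6) mod 6 < 6" by simp
  ultimately consider "k = 6 * m + 6" | "k = 6 * m + 7" | "k = 6 * m + 8" | "k = 6 * m + 9"
    | "k = 6 * m + 10" | "k = 6 * m + 11" by linarith
  then show ?thesis
  proof cases
    case 1
    then have "nat (12 * (6 * int m + 6) + 4) = 12 * k + 4" by simp
    then show ?thesis using difference_certificate_one_rotational[OF certificate_6, of m] by metis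
  next
    case 2
    then have "nat (12 * (6 * int m + 7) + 4) = 12 * k + 4" by simp
    then show ?thesis using difference_certificate_one_rotational[OF certificate_7, of m] by metis
  next
    case 3
    then have "nat (12 * (6 * int m + 8) + 4) = 12 * k + 4" by simp
    then show ?thesis using difference_certificate_one_rotational[OF certificate_8, of m] by metis
  next
    case 4
    then have "nat (12 * (6 * int m + 9) + 4) = 12 * k + 4" by simp
    then show ?thesis using difference_certificate_one_rotational[OF certificate_9, of m] by metis
  next
    case 5
    then have "nat (12 * (6 * int m + 10) + 4) = 12 * k + 4" by simp
    then show ?thesis using difference_certificate_one_rotational[OF certificate_10, of m] by metis
  next
    case 6
    then have "nat (12 * (6 * int m + 11) + 4) = 12 * k + 4" by simp
    then show ?thesis using difference_certificate_one_rotational[OF certificate_11, of m] by metis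
  qed
qed

theorem theorem3p2:
  fixes v :: nat
  assumes "v \<ge> 2"
  shows "(\<exists>(X :: nat set) \<B>. one_rotational_steiner_system_2 4 v X \<B>)
           \<longleftrightarrow> [v = 4] (mod 12) \<and> v \<noteq> 28"
proof
  assume "\<exists>(X :: nat set) \<B>. one_rotational_steiner_system_2 4 v X \<B>"
  then obtain \<C> where lines: "rotational_lines (int v - 1) \<C>"
    using rotational_lines_of_system assms by blast
  have "(int v - 1) mod 12 = 3" "int v - 1 \<noteq> 27"
    using rotational_lines.order_cong[OF lines] rotational_lines.order_not_27[OF lines] by auto
  then have "v mod 12 = 4 \<and> v \<noteq> 28" by presburger
  then show "[v = 4] (mod 12) \<and> v \<noteq> 28" by (simp add: cong_def)
next
  assume v: "[v = 4] (mod 12) \<and> v \<noteq> 28"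
  define k where "k = v div 12"
  have "v mod 12 = 4" using v by (simp add: cong_def)
  then have "v = 12 * k + 4" unfolding k_def by presburger
  moreover from this have "k \<noteq> 2" using v by auto
  ultimately show "\<exists>(X :: nat set) \<B>. one_rotational_steiner_system_2 4 v X \<B>"
    using one_rotational_existence by simp
qed

end
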